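(* Let $a,b,c,d\ge 2$ be integers, at most one of which equals $2$. Suppose $\gcd(ab,c)=1$, $\gcd(abc,d)=1$, and $\gcd(a,b)\notin\{a,b\}$ (i.e. neither of $a,b$ divides the other). Then $\mathbb{C}[X,Y,Z,T]/(X^a+Y^b+Z^c+T^d)$ is rigid.
   Context: A locally nilpotent derivation (LND) of a $\mathbb{C}$-algebra is a $\mathbb{C}$-linear derivation $D$ such that every element is killed by some power of $D$. A ring is rigid if its only LND is zero. *)

theory Defs
  imports "HOL-Computational_Algebra.Polynomial" "HOL-Algebra.QuotRing"
begin

text \<open>The polynomial ring C[X,Y,Z,T], realised as iterated univariate polynomials
  (outermost variable X, innermost variable T).\<close>
type_synonym mpoly4 = "complex poly poly poly poly"

definition varX :: mpoly4 where "varX = [:0, 1:]"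
definition varY :: mpoly4 where "varY = [:[:0, 1:]:]"
definition varZ :: mpoly4 where "varZ = [:[:[:0, 1:]:]:]"
definition varT :: mpoly4 where "varT = [:[:[:[:0, 1:]:]:]:]"
definition constC :: "complex \<Rightarrow> mpoly4" where "constC c = [:[:[:[:c:]:]:]:]"

definition polyring4 :: "mpoly4 ring" where
  "polyring4 = \<lparr>carrier = UNIV, monoid.mult = (*), one = 1, zero = 0, add = (+)\<rparr>"

definition hyper_ideal :: "nat \<Rightarrow> nat \<Rightarrow> nat \<Rightarrow> nat \<Rightarrow> mpoly4 set" where
  "hyper_ideal a b c d = genideal polyring4 {varX ^ a + varY ^ b + varZ ^ c + varT ^ d}"

definition hyper_ring :: "nat \<Rightarrow> nat \<Rightarrow> nat \<Rightarrow> nat \<Rightarrow> mpoly4 set ring" where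
  "hyper_ring a b c d = polyring4 Quot hyper_ideal a b c d"

definition hyper_emb :: "nat \<Rightarrow> nat \<Rightarrow> nat \<Rightarrow> nat \<Rightarrow> complex \<Rightarrow> mpoly4 set" where
  "hyper_emb a b c d z = a_r_coset polyring4 (hyper_ideal a b c d) (constC z)"

definition is_LND :: "('a, 'b) ring_scheme \<Rightarrow> (complex \<Rightarrow> 'a) \<Rightarrow> ('a \<Rightarrow> 'a) \<Rightarrow> bool" where
  "is_LND B emb D \<longleftrightarrow>
     D \<in> carrier B \<rightarrow> carrier B \<and>
     (\<forall>x\<in>carrier B. \<forall>y\<in>carrier B. D (x \<oplus>\<^bsub>B\<^esub> y) = D x \<oplus>\<^bsub>B\<^esub> D y) \<and>
     (\<forall>z. \<forall>x\<in>carrier B. D (emb z \<otimes>\<^bsub>B\<^esub> x) = emb z \<otimes>\<^bsub>B\<^esub> D x) \<and>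
     (\<forall>x\<in>carrier B. \<forall>y\<in>carrier B.
        D (x \<otimes>\<^bsub>B\<^esub> y) = (x \<otimes>\<^bsub>B\<^esub> D y) \<oplus>\<^bsub>B\<^esub> (D x \<otimes>\<^bsub>B\<^esub> y)) \<and>
     (\<forall>x\<in>carrier B. \<exists>n. (D ^^ n) x = \<zero>\<^bsub>B\<^esub>)"

definition rigid :: "('a, 'b) ring_scheme \<Rightarrow> (complex \<Rightarrow> 'a) \<Rightarrow> bool" where
  "rigid B emb \<longleftrightarrow> (\<forall>D. is_LND B emb D \<longrightarrow> (\<forall>x\<in>carrier B. D x = \<zero>\<^bsub>B\<^esub>))"

end

theory Submission
  imports Defs
begin

text \<open>Give \<open>X, Y, Z, T\<close> the weights \<open>b c d, a c d, a b d, a b c\<close>. If there is a nonzero locally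
  nilpotent derivation, its leading homogeneous part \<open>\<Delta>\<close> is again a nonzero one; let \<open>\<nu>\<close> be the
  associated degree function. Since \<open>d\<close> is prime to the weight of \<open>t\<close> and divides the other weights,
  degree considerations modulo \<open>d\<close> show that either \<open>\<Delta> t = 0\<close>, or \<open>\<nu> t = 1\<close> and \<open>t ^ (d - 1)\<close>
  divides \<open>\<Delta> x\<close>, \<open>\<Delta> y\<close> and \<open>\<Delta> z\<close>. The same holds for \<open>z\<close> and \<open>c\<close>, so \<open>\<Delta> z\<close> and \<open>\<Delta> t\<close> are not
  both nonzero. Let \<open>s = x ^ a + y ^ b = - (z ^ c + t ^ d)\<close>. If \<open>\<Delta> z = \<Delta> t = 0\<close>, then \<open>s\<close> is a
  constant, which forces \<open>\<Delta> x = \<Delta> y = 0\<close>. If, say, \<open>\<Delta> t \<noteq> 0\<close>, divide the identity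
  \<open>x ^ (a - 1) (b x \<Delta> y - a y \<Delta> x) = b s \<Delta> y - y \<Delta> s\<close> by \<open>t ^ (d - 1)\<close> and compare degrees:
  \<open>(a - 1) \<nu> x \<le> \<nu> y\<close> and likewise \<open>(b - 1) \<nu> y \<le> \<nu> x\<close>, which is impossible unless \<open>a = b = 2\<close>.\<close>

section \<open>Residues modulo an integer prime to a weight\<close>

lemma coprime_residue:
  fixes N n :: int
  assumes "coprime N (int d)" "d > 0"
  shows "\<exists>j<d. int d dvd n - N * int j"
proof -
  obtain i k where "i * N + k * int d = 1" using bezout_int[of N "int d"] assms(1) by auto
  then have "N * i - 1 = int d * (- k)" by (simp add: algebra_simps)
  then have i: "int d dvd N * i - 1" by (metis dvd_triv_left)
  define j where "j = nat ((n * i) mod int d)"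
  have "int d dvd n * i - int j" using assms(2) by (simp add: j_def mod_eq_dvd_iff[symmetric])
  then have "int d dvd N * (n * i - int j) - n * (N * i - 1)" using i by fastforce
  then have "int d dvd n - N * int j" by (simp add: algebra_simps)
  moreover have "j < d" using assms(2) by (simp add: j_def nat_less_iff)
  ultimately show ?thesis by blast
qed

lemma dvd_of_dvd_mult_coprime:
  fixes N :: int
  assumes "coprime N (int d)" "int d dvd N * k"
  shows "int d dvd k"
  using assms by (simp add: coprime_commute coprime_dvd_mult_right_iff)


section \<open>Homogeneous locally nilpotent derivations\<close>

text \<open>The ring acted on need not exhaust the type \<open>'r\<close>: only its homogeneous
  elements are singled out, by \<open>hom\<close>, and the laws for \<open>\<Delta>\<close> are
  restricted to them. Degrees are integers because \<open>\<Delta>\<close> may lower them; zero is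
  homogeneous of every degree.\<close>

locale homogeneous_lnd =
  fixes hom :: "int \<Rightarrow> 'r::{idom,ring_char_0} \<Rightarrow> bool" and \<Delta> :: "'r \<Rightarrow> 'r" and e :: int
  assumes hom_zero: "hom n 0"
    and hom_one: "hom 0 1"
    and hom_uminus_one: "hom 0 (-1)"
    and hom_add: "hom n u \<Longrightarrow> hom n v \<Longrightarrow> hom n (u + v)"
    and hom_mult: "hom m u \<Longrightarrow> hom n v \<Longrightarrow> hom (m + n) (u * v)"
    and der_hom: "hom n u \<Longrightarrow> hom (n + e) (\<Delta> u)"
    and der_add: "hom n u \<Longrightarrow> hom n v \<Longrightarrow> \<Delta> (u + v) = \<Delta> u + \<Delta> v"
    and der_mult: "hom m u \<Longrightarrow> hom n v \<Longrightarrow> \<Delta> (u * v) = u * \<Delta> v + \<Delta> u * v"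
    and nilpotent: "hom n u \<Longrightarrow> \<exists>k. (\<Delta> ^^ k) u = 0"
begin

lemma der_zero: "\<Delta> 0 = 0"
  using der_add[OF hom_zero hom_zero] by simp

lemma iter_der_zero: "(\<Delta> ^^ k) 0 = 0"
  by (induction k) (simp_all add: der_zero)

lemma hom_uminus: "hom n u \<Longrightarrow> hom n (- u)"
  using hom_mult[OF hom_uminus_one, of n u] by simp

lemma hom_diff: "hom n u \<Longrightarrow> hom n v \<Longrightarrow> hom n (u - v)"
  using hom_add[of n u "- v"] hom_uminus[of n v] by simp

lemma hom_of_nat: "hom 0 (of_nat k)"
  by (induction k) (auto intro: hom_zero hom_add hom_one)

lemma hom_of_nat_mult: "hom n u \<Longrightarrow> hom n (of_nat k * u)"
  using hom_mult[OF hom_of_nat, of n u k] by simp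

lemma hom_power: "hom n u \<Longrightarrow> hom (int k * n) (u ^ k)"
  by (induction k) (auto intro: hom_one dest: hom_mult simp: algebra_simps)

lemma der_one: "\<Delta> 1 = 0"
  using der_mult[OF hom_one hom_one] by simp

lemma der_uminus: "hom n u \<Longrightarrow> \<Delta> (- u) = - \<Delta> u"
  using der_add[OF _ hom_uminus, of n u u] der_zero by (simp add: eq_neg_iff_add_eq_0 add.commute)

lemma der_of_nat: "\<Delta> (of_nat k) = 0"
proof (induction k)
  case (Suc k)
  then show ?case using der_add[OF hom_one hom_of_nat, of k] by (simp add: der_one)
qed (simp add: der_zero)

lemma der_power: "hom n u \<Longrightarrow> \<Delta> (u ^ Suc k) = of_nat (Suc k) * u ^ k * \<Delta> u"
proof (induction k)
  case (Suc k)
  have "\<Delta> (u * u ^ Suc k) = u * \<Delta> (u ^ Suc k) + \<Delta> u * u ^ Suc k"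
    using der_mult[OF Suc.prems hom_power[OF Suc.prems]] .
  then show ?case using Suc by (simp add: algebra_simps)
qed simp

section \<open>Iterated derivatives and the associated degree function\<close>

lemma iter_add: "hom n u \<Longrightarrow> hom n v \<Longrightarrow> (\<Delta> ^^ k) (u + v) = (\<Delta> ^^ k) u + (\<Delta> ^^ k) v"
proof (induction k arbitrary: n u v)
  case (Suc k)
  then show ?case using Suc.IH[OF der_hom der_hom] der_add
    by (simp add: funpow_Suc_right del: funpow.simps)
qed simp

text \<open>In the Leibniz expansion of order \<open>p + q\<close>, every other term differentiates
  \<open>u\<close> more than \<open>p\<close> times or \<open>v\<close> more than \<open>q\<close>
  times and vanishes. The induction splits off one derivative and recombines by Pascal's
  rule.\<close>

lemma iter_mult_top:
  assumes "hom m u" "hom n v" "(\<Delta> ^^ Suc p) u = 0" "(\<Delta> ^^ Suc q) v = 0"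
  shows "(\<Delta> ^^ (p + q)) (u * v) = of_nat ((p + q) choose p) * (\<Delta> ^^ p) u * (\<Delta> ^^ q) v"
  using assms
proof (induction "p + q" arbitrary: p q u v m n)
  case 0 then show ?case by simp
next
  case (Suc k)
  have l: "hom (m + n + e) (u * \<Delta> v)" "hom (m + n + e) (\<Delta> u * v)"
    using hom_mult[OF Suc.prems(1) der_hom[OF Suc.prems(2)]] hom_mult[OF der_hom[OF Suc.prems(1)] Suc.prems(2)]
    by (simp_all add: algebra_simps)
  have "(\<Delta> ^^ (p + q)) (u * v) = (\<Delta> ^^ k) (u * \<Delta> v + \<Delta> u * v)"
    using der_mult[OF Suc.prems(1,2)] by (simp flip: Suc.hyps(2) add: funpow_swap1)
  also have "\<dots> = (\<Delta> ^^ k) (u * \<Delta> v) + (\<Delta> ^^ k) (\<Delta> u * v)" using iter_add l .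
  finally have eq: "(\<Delta> ^^ (p + q)) (u * v) = (\<Delta> ^^ k) (u * \<Delta> v) + (\<Delta> ^^ k) (\<Delta> u * v)" .
  note ij = Suc.prems(1,2)[THEN der_hom]
  have A: "(\<Delta> ^^ k) (u * \<Delta> v) = of_nat (k choose p) * (\<Delta> ^^ p) u * (\<Delta> ^^ q) v" if "q = Suc q'" for q'
    using Suc.hyps(1)[of p q' m u "n + e" "\<Delta> v"] Suc.hyps(2) Suc.prems ij that
    by (simp add: funpow_swap1)
  have B: "(\<Delta> ^^ k) (\<Delta> u * v) = of_nat (k choose p') * (\<Delta> ^^ p) u * (\<Delta> ^^ q) v" if "p = Suc p'" for p'
    using Suc.hyps(1)[of p' q "m + e" "\<Delta> u" n v] Suc.hyps(2) Suc.prems ij that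
    by (simp add: funpow_swap1)
  show ?case
  proof (cases p)
    case 0
    then obtain q' where q': "q = Suc q'" using Suc.hyps(2) by (cases q) auto
    from 0 Suc.prems have "\<Delta> u = 0" by simp
    then show ?thesis using eq A[OF q'] 0 by (simp add: iter_der_zero)
  next
    case (Suc p')
    show ?thesis
    proof (cases q)
      case 0
      with Suc.prems have "\<Delta> v = 0" by simp
      then show ?thesis using eq B[OF Suc] 0 Suc Suc.hyps(2) by (simp add: iter_der_zero)
    next
      case (Suc q')
      have "p + q = Suc k" using Suc.hyps(2) by simp
      then show ?thesis using eq A[OF Suc] B[OF \<open>p = Suc p'\<close>] \<open>p = Suc p'\<close>
        by (simp add: algebra_simps)
    qed
  qed
qed

text \<open>The usual degree function of a locally nilpotent derivation, except that zero gets the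
  value 0 rather than minus infinity; hence the nonvanishing assumptions below.\<close>

definition \<nu> :: "'r \<Rightarrow> nat" where "\<nu> u = (LEAST k. (\<Delta> ^^ Suc k) u = 0)"

lemma nu_top:
  assumes "hom n u" "u \<noteq> 0"
  shows "(\<Delta> ^^ Suc (\<nu> u)) u = 0" "(\<Delta> ^^ \<nu> u) u \<noteq> 0"
proof -
  obtain k where k: "(\<Delta> ^^ k) u = 0" using nilpotent assms by blast
  with assms(2) obtain k' where "k = Suc k'" by (cases k) auto
  with k have ex: "(\<Delta> ^^ Suc k') u = 0" by simp
  show "(\<Delta> ^^ Suc (\<nu> u)) u = 0" unfolding \<nu>_def by (rule LeastI[of "\<lambda>k. (\<Delta> ^^ Suc k) u = 0", OF ex])
  show "(\<Delta> ^^ \<nu> u) u \<noteq> 0"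
  proof (cases "\<nu> u")
    case (Suc j)
    then show ?thesis using not_less_Least[of j "\<lambda>k. (\<Delta> ^^ Suc k) u = 0"] unfolding \<nu>_def by simp
  qed (simp add: assms)
qed

lemma nu_le: "(\<Delta> ^^ Suc k) u = 0 \<Longrightarrow> \<nu> u \<le> k"
  unfolding \<nu>_def by (rule Least_le)

lemma nu_eqI:
  assumes "(\<Delta> ^^ Suc k) u = 0" "(\<Delta> ^^ k) u \<noteq> 0"
  shows "\<nu> u = k"
proof (rule antisym[OF nu_le[OF assms(1)]], rule ccontr)
  assume "\<not> k \<le> \<nu> u"
  then obtain j where j: "k = j + Suc (\<nu> u)" by (metis add.commute less_imp_Suc_add not_le add_Suc_right add_Suc)
  have "(\<Delta> ^^ Suc (\<nu> u)) u = 0" unfolding \<nu>_def by (rule LeastI[of "\<lambda>k. (\<Delta> ^^ Suc k) u = 0", OF assms(1)])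
  then have "(\<Delta> ^^ k) u = 0" unfolding j funpow_add by (simp del: funpow.simps add: iter_der_zero)
  with assms show False by simp
qed

text \<open>The top derivatives multiply to a binomial multiple of a product of nonzero elements,
  which is nonzero in a domain of characteristic zero.\<close>

lemma nu_mult:
  assumes "hom m u" "hom n v" "u \<noteq> 0" "v \<noteq> 0"
  shows "\<nu> (u * v) = \<nu> u + \<nu> v"
proof (rule nu_eqI)
  note u = nu_top[OF assms(1,3)] and v = nu_top[OF assms(2,4)]
  show "(\<Delta> ^^ (\<nu> u + \<nu> v)) (u * v) \<noteq> 0"
    using iter_mult_top[OF assms(1,2) u(1) v(1)] u(2) v(2) by simp
  \<comment> \<open>Raising the first order by one makes the factor coming from \<open>u\<close>
    vanish, so the next derivative of the product is zero.\<close>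
  have "(\<Delta> ^^ Suc (Suc (\<nu> u))) u = 0" using u(1) by (simp add: der_zero)
  from iter_mult_top[OF assms(1,2) this v(1)] u(1)
  show "(\<Delta> ^^ Suc (\<nu> u + \<nu> v)) (u * v) = 0" by simp
qed

lemma nu_power: "hom n u \<Longrightarrow> u \<noteq> 0 \<Longrightarrow> \<nu> (u ^ k) = k * \<nu> u"
proof (induction k)
  case 0 show ?case using nu_le[of 0 1] by (simp add: der_one)
next
  case (Suc k)
  then show ?case using nu_mult[OF Suc.prems(1) hom_power[OF Suc.prems(1)]] by simp
qed

lemma nu_der: "hom n u \<Longrightarrow> \<Delta> u \<noteq> 0 \<Longrightarrow> \<nu> u = Suc (\<nu> (\<Delta> u))"
proof (rule nu_eqI)
  assume a: "hom n u" "\<Delta> u \<noteq> 0"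
  from nu_top[OF der_hom[OF a(1)] a(2)] show "(\<Delta> ^^ Suc (Suc (\<nu> (\<Delta> u)))) u = 0" "(\<Delta> ^^ Suc (\<nu> (\<Delta> u))) u \<noteq> 0"
    by (simp_all add: funpow_swap1)
qed

lemma nu_const: "\<Delta> u = 0 \<Longrightarrow> \<nu> u = 0"
  using nu_le[of 0 u] by simp

lemma nu_of_nat_mult:
  assumes "hom n u" "u \<noteq> 0" "k > 0"
  shows "\<nu> (of_nat k * u) = \<nu> u"
  using nu_mult[OF hom_of_nat assms(1), of k] nu_const[OF der_of_nat, of k] assms by simp

lemma nu_eq_0_iff: "hom n u \<Longrightarrow> u \<noteq> 0 \<Longrightarrow> \<nu> u = 0 \<longleftrightarrow> \<Delta> u = 0"
  using nu_der nu_const by fastforce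

text \<open>\<open>\<Delta>\<close> lowers the degree of a nonconstant element by one, whereas
  multiplication by a nonzero \<open>w\<close> cannot lower it.\<close>

lemma der_eq_0_of_dvd:
  assumes "hom n u" "hom k w" "\<Delta> u = u * w"
  shows "\<Delta> u = 0"
proof (rule ccontr)
  assume a: "\<Delta> u \<noteq> 0"
  then have "u \<noteq> 0" "w \<noteq> 0" using assms der_zero by auto
  with nu_mult[OF assms(1,2)] nu_der[OF assms(1) a] assms(3) show False by simp
qed

lemma iter_le_nu:
  assumes "hom n u" "u \<noteq> 0" "\<nu> u \<le> k"
  shows "(\<Delta> ^^ Suc k) u = 0"
proof -
  obtain j where j: "k = j + \<nu> u" using assms(3) by (metis add.commute le_iff_add)
  have "(\<Delta> ^^ Suc k) u = (\<Delta> ^^ j) ((\<Delta> ^^ Suc (\<nu> u)) u)"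
    unfolding j by (metis add_Suc_right comp_apply funpow_add)
  then show ?thesis using nu_top(1)[OF assms(1,2)] by (simp add: iter_der_zero)
qed

lemma nu_add_le:
  assumes "hom n u" "hom n v" "u = 0 \<or> \<nu> u \<le> k" "v = 0 \<or> \<nu> v \<le> k"
  shows "\<nu> (u + v) \<le> k"
proof (rule nu_le)
  have "(\<Delta> ^^ Suc k) u = 0" "(\<Delta> ^^ Suc k) v = 0"
    using iter_le_nu assms iter_der_zero by blast+
  then show "(\<Delta> ^^ Suc k) (u + v) = 0" using iter_add[OF assms(1,2), of "Suc k"] by (simp del: funpow.simps)
qed

text \<open>Comparing the top terms of \<open>k u v' = v u'\<close> amounts to integrating \<open>u'/u = k v'/v\<close>.\<close>
lemma nu_of_log_derivative:
  assumes u: "hom m u" "\<Delta> u \<noteq> 0" and v: "hom n v" "\<Delta> v \<noteq> 0"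
    and eq: "of_nat k * (u * \<Delta> v) = v * \<Delta> u"
  shows "\<nu> u = k * \<nu> v"
proof -
  have nz: "u \<noteq> 0" "v \<noteq> 0" using u v der_zero by auto
  note ij = der_hom[OF u(1)] der_hom[OF v(1)]
  define p where "p = \<nu> (\<Delta> v)"
  define q where "q = \<nu> (\<Delta> u)"
  have pv: "\<nu> v = Suc p" and qu: "\<nu> u = Suc q" using nu_der u v by (auto simp: p_def q_def)
  note tu = nu_top[OF u(1) nz(1), unfolded qu] and tv = nu_top[OF v(1) nz(2), unfolded pv]
  have du: "(\<Delta> ^^ Suc q) (\<Delta> u) = 0" and dv: "(\<Delta> ^^ Suc p) (\<Delta> v) = 0"
    using nu_top(1)[OF ij(1) u(2)] nu_top(1)[OF ij(2) v(2)] by (auto simp: p_def q_def)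
  let ?w = "(\<Delta> ^^ Suc q) u * (\<Delta> ^^ Suc p) v" and ?N = "Suc (p + q)"
  have 1: "(\<Delta> ^^ ?N) (u * \<Delta> v) = of_nat (?N choose Suc q) * ?w"
    using iter_mult_top[OF u(1) ij(2) tu(1) dv] by (simp add: funpow_swap1 add.commute mult.assoc)
  have 2: "(\<Delta> ^^ ?N) (v * \<Delta> u) = of_nat (?N choose Suc p) * ?w"
    using iter_mult_top[OF v(1) ij(1) tv(1) du] by (simp add: funpow_swap1 mult.commute mult.left_commute)
  have iter_scale: "(\<Delta> ^^ l) (of_nat k * w) = of_nat k * (\<Delta> ^^ l) w" if "hom n w" for n w l
    using that
  proof (induction l arbitrary: n w)
    case (Suc l)
    with Suc.IH[OF der_hom] der_mult[OF hom_of_nat Suc.prems] show ?case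
      by (simp add: der_of_nat funpow_Suc_right del: funpow.simps)
  qed simp
  have "of_nat k * (of_nat (?N choose Suc q) * ?w) = of_nat (?N choose Suc p) * ?w"
    using iter_scale[OF hom_mult[OF u(1) ij(2)], of ?N] 1 2 eq by metis
  then have "of_nat (k * (?N choose Suc q)) * ?w = of_nat (?N choose Suc p) * ?w"
    by (simp add: mult.assoc)
  then have "of_nat (k * (?N choose Suc q)) = (of_nat (?N choose Suc p) :: 'r)"
    using tu(2) tv(2) by simp
  \<comment> \<open>With the nonzero top derivatives cancelled, the ratio of neighbouring binomial
    coefficients turns this into \<open>Suc p * k = Suc q\<close>.\<close>
  then have c: "k * (?N choose Suc q) = ?N choose Suc p" by (simp only: of_nat_eq_iff)
  have sym: "?N choose Suc q = ?N choose p"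
    using binomial_symmetric[of "Suc q" ?N] by simp
  have "Suc p * (?N choose Suc p) = (?N choose p) * Suc q"
  proof -
    have "Suc q * (?N choose p) = ?N * ((p + q) choose p)"
      using binomial_absorb_comp[of ?N p] by (simp del: binomial_Suc_Suc)
    then show ?thesis using Suc_times_binomial[of p "p + q"] by (metis mult.commute)
  qed
  then have "Suc p * k * (?N choose p) = Suc q * (?N choose p)"
    by (metis c sym mult.assoc mult.commute)
  moreover have "(?N choose p) > 0" by simp
  ultimately have "Suc p * k = Suc q" using mult_right_cancel by blast
  then show ?thesis using pv qu by (simp add: mult.commute)
qed


text \<open>Models a generator \<open>t\<close> of degree prime to \<open>d\<close> when all other
  generators have degree divisible by \<open>d\<close>: the degree of a homogeneous element fixes
  the exponent of \<open>t\<close> modulo \<open>d\<close> in all its terms, and \<open>t\<close> to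
  the least such exponent divides it.\<close>

definition root_divides :: "'r \<Rightarrow> int \<Rightarrow> nat \<Rightarrow> bool" where
  "root_divides t N d \<longleftrightarrow> hom N t \<and> t \<noteq> 0 \<and> d \<ge> 2 \<and> coprime N (int d) \<and>
     (\<forall>n u j. hom n u \<longrightarrow> j < d \<longrightarrow> int d dvd n - N * int j \<longrightarrow>
        (\<exists>v. hom (n - N * int j) v \<and> u = t ^ j * v))"

text \<open>If \<open>e\<close> is not \<open>- N\<close> modulo \<open>d\<close>, then \<open>t\<close> divides \<open>\<Delta> t\<close> for degree reasons, which forces
  \<open>\<Delta> t = 0\<close>.\<close>
lemma root_der:
  assumes root: "root_divides t N d" and nz: "\<Delta> t \<noteq> 0"
  shows "\<Delta> (\<Delta> t) = 0"
    and "hom n u \<Longrightarrow> int d dvd n \<Longrightarrow> \<exists>v. hom (n + e - N * int (d - 1)) v \<and> \<Delta> u = t ^ (d - 1) * v"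
proof -
  have t: "hom N t" "t \<noteq> 0" and d: "d \<ge> 2" and cop: "coprime N (int d)"
    and dv: "\<And>n u j. hom n u \<Longrightarrow> j < d \<Longrightarrow> int d dvd n - N * int j \<Longrightarrow>
        \<exists>v. hom (n - N * int j) v \<and> u = t ^ j * v"
    using root unfolding root_divides_def by auto
  obtain j where j: "j < d" and jd: "int d dvd N + e - N * int j"
    using coprime_residue[OF cop] d by (metis less_le_trans pos2)
  have j0: "j = 0"
  proof (rule ccontr)
    assume "j \<noteq> 0"
    then obtain j' where j': "j = Suc j'" by (cases j) auto
    obtain v where v: "hom (N + e - N * int j) v" "\<Delta> t = t ^ j * v"
      using dv[OF der_hom[OF t(1)] j jd] by blast
    have "hom (int j' * N + (N + e - N * int j)) (t ^ j' * v)" using hom_mult hom_power t v by blast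
    moreover have "\<Delta> t = t * (t ^ j' * v)" using v j' by (simp add: mult.assoc)
    ultimately show False using der_eq_0_of_dvd t(1) nz by blast
  qed
  have ed: "int d dvd N + e" using jd j0 by simp
  \<comment> \<open>Here \<open>n + e\<close> is congruent to \<open>- N\<close>, that is to
    \<open>N * (d - 1)\<close>, modulo \<open>d\<close>.\<close>
  have key: "\<exists>v. hom (n + e - N * int (d - 1)) v \<and> \<Delta> u = t ^ (d - 1) * v"
    if "hom n u" "int d dvd n" for n u
  proof (rule dv[OF der_hom[OF that(1)]])
    have "n + e - N * int (d - 1) = n + (N + e) - N * int d"
      using d by (simp add: of_nat_diff algebra_simps)
    moreover have "int d dvd n + (N + e) - N * int d" using ed that(2) by simp
    ultimately show "int d dvd n + e - N * int (d - 1)" by metis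
  qed (use d in simp)
  then show "hom n u \<Longrightarrow> int d dvd n \<Longrightarrow> \<exists>v. hom (n + e - N * int (d - 1)) v \<and> \<Delta> u = t ^ (d - 1) * v" .
  show "\<Delta> (\<Delta> t) = 0"
  proof (rule ccontr)
    assume nz2: "\<Delta> (\<Delta> t) \<noteq> 0"
    \<comment> \<open>\<open>\<Delta> t\<close> has degree \<open>N + e\<close>, divisible by
      \<open>d\<close>, so \<open>key\<close> applies to it; then \<open>\<nu> t - 2\<close> would
      be at least \<open>(d - 1) * \<nu> t\<close>.\<close>
    obtain v where v: "hom (N + e + e - N * int (d - 1)) v" "\<Delta> (\<Delta> t) = t ^ (d - 1) * v"
      using key[OF der_hom[OF t(1)] ed] by blast
    then have "v \<noteq> 0" using nz2 by auto
    then have "\<nu> (\<Delta> (\<Delta> t)) = (d - 1) * \<nu> t + \<nu> v"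
      using nu_mult[OF hom_power[OF t(1)] v(1)] nu_power[OF t] t v(2) by simp
    moreover have "\<nu> t = Suc (Suc (\<nu> (\<Delta> (\<Delta> t))))"
      using nu_der[OF t(1) nz] nu_der[OF der_hom[OF t(1)] nz2] by simp
    moreover have "(d - 1) * \<nu> t \<ge> 1 * \<nu> t" using d by (intro mult_le_mono1) simp
    ultimately show False by linarith
  qed
qed

lemma nu_root: "root_divides t N d \<Longrightarrow> \<Delta> t \<noteq> 0 \<Longrightarrow> \<nu> t = 1"
  using nu_der[of N t] nu_const[OF root_der(1)] by (simp add: root_divides_def)

text \<open>A nonzero \<open>\<Delta> z\<close> would be divisible by \<open>t ^ (d - 1)\<close> and
  so have positive degree, while \<open>\<Delta> (\<Delta> z) = 0\<close> makes its degree
  zero.\<close>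

lemma root_der_exclusive:
  assumes t: "root_divides t N d" and z: "root_divides z M c"
    and "int d dvd M" and "\<Delta> t \<noteq> 0"
  shows "\<Delta> z = 0"
proof (rule ccontr)
  assume nz: "\<Delta> z \<noteq> 0"
  have tt: "hom N t" "t \<noteq> 0" "d \<ge> 2" and zz: "hom M z" using t z by (auto simp: root_divides_def)
  obtain v where v: "hom (M + e - N * int (d - 1)) v" "\<Delta> z = t ^ (d - 1) * v"
    using root_der(2)[OF t \<open>\<Delta> t \<noteq> 0\<close> zz assms(3)] by blast
  with nz have "v \<noteq> 0" by auto
  then have "\<nu> (\<Delta> z) = (d - 1) * \<nu> t + \<nu> v"
    using nu_mult[OF hom_power[OF tt(1)] v(1)] nu_power[OF tt(1,2)] tt v(2) by simp
  moreover have "\<nu> (\<Delta> z) = 0" using root_der(1)[OF z nz] nu_const by blast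
  ultimately show False using nu_root[OF t \<open>\<Delta> t \<noteq> 0\<close>] tt(3) by simp
qed

section \<open>Sums of two powers under the derivation\<close>

lemma der_power_sum:
  assumes "hom wx x" "hom wy y" "int a * wx = int b * wy" "a \<ge> 1" "b \<ge> 1"
  shows "\<Delta> (x ^ a + y ^ b) = of_nat a * x ^ (a - 1) * \<Delta> x + of_nat b * y ^ (b - 1) * \<Delta> y"
proof -
  have "hom (int a * wx) (x ^ a)" "hom (int a * wx) (y ^ b)"
    using hom_power[OF assms(1), of a] hom_power[OF assms(2), of b] assms(3) by auto
  then show ?thesis using der_add der_power[OF assms(1), of "a - 1"] der_power[OF assms(2), of "b - 1"] assms
    by simp
qed

text \<open>The Wronskian-type identity behind the Mason--Stothers theorem.\<close>
lemma power_sum_identity: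
  assumes "hom wx x" "hom wy y" "int a * wx = int b * wy" "a \<ge> 1" "b \<ge> 1"
  shows "x ^ (a - 1) * (of_nat b * (x * \<Delta> y) - of_nat a * (y * \<Delta> x)) =
         of_nat b * ((x ^ a + y ^ b) * \<Delta> y) - y * \<Delta> (x ^ a + y ^ b)"
proof -
  have "x ^ a = x * x ^ (a - 1)" "y ^ b = y * y ^ (b - 1)"
    using assms(4,5) by (metis Suc_pred' less_eq_Suc_le One_nat_def power_Suc)+
  then show ?thesis unfolding der_power_sum[OF assms] by (simp add: algebra_simps)
qed

text \<open>For a constant sum \<open>s\<close> the identity reads
  \<open>x ^ (a - 1) * v = of_nat b * (s * \<Delta> y)\<close>, whose right side has degree
  \<open>\<nu> y - 1\<close>.\<close>

lemma power_sum_const_aux: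
  assumes xy: "hom wx x" "hom wy y" "x \<noteq> 0" "y \<noteq> 0" and w: "int a * wx = int b * wy" "a \<ge> 2" "b \<ge> 2"
    and s: "\<Delta> (x ^ a + y ^ b) = 0" "x ^ a + y ^ b \<noteq> 0" and nz: "\<Delta> y \<noteq> 0"
  shows "\<nu> x < \<nu> y"
proof -
  define s where "s = x ^ a + y ^ b"
  define v where "v = of_nat b * (x * \<Delta> y) - of_nat a * (y * \<Delta> x)"
  have hs: "hom (int a * wx) s"
    unfolding s_def using hom_add hom_power xy(1,2) w(1) by metis
  have "hom (wx + wy + e) (x * \<Delta> y)" "hom (wx + wy + e) (y * \<Delta> x)"
    using hom_mult[OF xy(1) der_hom[OF xy(2)]] hom_mult[OF xy(2) der_hom[OF xy(1)]]
    by (simp_all add: ac_simps)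
  then have hv: "hom (wx + wy + e) v" unfolding v_def by (intro hom_diff hom_of_nat_mult)
  have eq: "x ^ (a - 1) * v = of_nat b * (s * \<Delta> y)"
    using power_sum_identity[OF xy(1,2) w(1)] w(2,3) s by (simp add: v_def s_def)
  have "s * \<Delta> y \<noteq> 0" using nz s by (simp add: s_def)
  then have "\<nu> (of_nat b * (s * \<Delta> y)) = \<nu> (s * \<Delta> y)" "of_nat b * (s * \<Delta> y) \<noteq> 0"
    using nu_of_nat_mult[OF hom_mult[OF hs der_hom[OF xy(2)]]] w by auto
  moreover have "\<nu> (s * \<Delta> y) = \<nu> (\<Delta> y)"
    using nu_mult[OF hs der_hom[OF xy(2)]] nu_const[of s] s nz by (simp add: s_def)
  ultimately have 1: "\<nu> (x ^ (a - 1) * v) = \<nu> (\<Delta> y)" "v \<noteq> 0" using eq by auto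
  then have "(a - 1) * \<nu> x + \<nu> v = \<nu> (\<Delta> y)"
    using nu_mult[OF hom_power[OF xy(1)] hv] nu_power[OF xy(1,3)] xy(3) by simp
  moreover have "(a - 1) * \<nu> x \<ge> 1 * \<nu> x" using w by (intro mult_le_mono1) simp
  ultimately show ?thesis using nu_der[OF xy(2) nz] by linarith
qed

text \<open>If one derivative is nonzero, so is the other, by differentiating the sum; the auxiliary
  bound used both ways is then contradictory.\<close>

lemma power_sum_const:
  assumes xy: "hom wx x" "hom wy y" "x \<noteq> 0" "y \<noteq> 0" and w: "int a * wx = int b * wy" "a \<ge> 2" "b \<ge> 2"
    and s: "\<Delta> (x ^ a + y ^ b) = 0" "x ^ a + y ^ b \<noteq> 0"
  shows "\<Delta> x = 0 \<and> \<Delta> y = 0"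
proof -
  have "\<Delta> x = 0 \<longleftrightarrow> \<Delta> y = 0"
    using der_power_sum[OF xy(1,2) w(1)] w(2,3) xy s(1) by auto
  moreover have "\<Delta> y \<noteq> 0 \<Longrightarrow> \<nu> x < \<nu> y" using power_sum_const_aux[OF xy w s] .
  moreover have "\<Delta> x \<noteq> 0 \<Longrightarrow> \<nu> y < \<nu> x"
    using power_sum_const_aux[OF xy(2,1,4,3) w(1)[symmetric] w(3,2)] s by (simp add: add.commute)
  ultimately show ?thesis by fastforce
qed

text \<open>Both \<open>\<Delta> x\<close> and \<open>\<Delta> y\<close> carry the factor
  \<open>t ^ (d - 1)\<close>. Cancelling it from the identity leaves
  \<open>x ^ (a - 1) * v = u\<close>. If \<open>u\<close> is nonzero, its degree is at most
  \<open>\<nu> y\<close> and the bound follows; \<open>u = 0\<close> is impossible.\<close>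

lemma root_power_sum_aux:
  assumes root: "root_divides t N d" and nz: "\<Delta> t \<noteq> 0"
    and xy: "hom wx x" "hom wy y" "x \<noteq> 0" "y \<noteq> 0" and dvd: "int d dvd wx" "int d dvd wy"
    and w: "int a * wx = N * int d" "int b * wy = N * int d" "a \<ge> 2" "b \<ge> 2"
    and s: "\<Delta> (x ^ a + y ^ b) = - of_nat d * t ^ (d - 1) * \<Delta> t" "\<nu> (x ^ a + y ^ b) = d"
  shows "(a - 1) * \<nu> x \<le> \<nu> y"
proof -
  have t: "hom N t" "t \<noteq> 0" "d \<ge> 2" using root by (auto simp: root_divides_def)
  define s where "s = x ^ a + y ^ b"
  define k where "k = e - N * int (d - 1)"
  have hs: "hom (N * int d) s"
    unfolding s_def using hom_add hom_power xy(1,2) w(1,2) by metis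
  have wab: "int a * wx = int b * wy" using w(1,2) by simp
  have ds: "\<Delta> s \<noteq> 0" using s(1) nz t by (simp add: s_def)
  then have sn: "s \<noteq> 0" using der_zero by auto
  obtain x' y' where x': "hom (wx + k) x'" "\<Delta> x = t ^ (d - 1) * x'"
    and y': "hom (wy + k) y'" "\<Delta> y = t ^ (d - 1) * y'"
    using root_der(2)[OF root nz] xy dvd unfolding k_def by (metis add_diff_eq)
  define v where "v = of_nat b * (x * y') - of_nat a * (y * x')"
  define u where "u = of_nat b * (s * y') + of_nat d * (\<Delta> t * y)"
  have tp: "t ^ (d - 1) \<noteq> 0" using t by simp
  have "hom (wx + wy + k) (x * y')" "hom (wx + wy + k) (y * x')"
    using hom_mult[OF xy(1) y'(1)] hom_mult[OF xy(2) x'(1)] by (simp_all add: ac_simps)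
  then have hv: "hom (wx + wy + k) v" unfolding v_def by (intro hom_diff hom_of_nat_mult)
  have "t ^ (d - 1) * (x ^ (a - 1) * v) = t ^ (d - 1) * u"
    using power_sum_identity[OF xy(1,2) wab] w(3,4) s(1)
    by (simp add: v_def u_def s_def x' y' algebra_simps)
  then have eq: "x ^ (a - 1) * v = u" by (rule mult_left_cancel[OF tp, THEN iffD1])
  have nut: "\<nu> t = 1" using nu_root root nz .
  \<comment> \<open>The factor \<open>t ^ (d - 1)\<close> of \<open>\<Delta> y\<close> contributes
    \<open>d - 1\<close>, and the application of \<open>\<Delta>\<close> accounts for one
    more.\<close>
  have nuy: "\<nu> y = d + \<nu> y'" if "y' \<noteq> 0"
    using nu_der[OF xy(2)] y' that tp nu_mult[OF hom_power[OF t(1)] y'(1) tp that] nu_power[OF t(1,2)] nut t(3)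
    by simp
  show ?thesis
  proof (cases "u = 0")
    case False
    have hdeg: "wy + N + e = N * int d + (wy + k)" using t(3) by (simp add: k_def of_nat_diff algebra_simps)
    have h1: "hom (wy + N + e) (s * y')" using hom_mult[OF hs y'(1)] hdeg by metis
    have h2: "hom (wy + N + e) (\<Delta> t * y)" using hom_mult[OF der_hom[OF t(1)] xy(2)] by (simp add: ac_simps)
    \<comment> \<open>In the first summand the degree \<open>d\<close> of \<open>s\<close> makes up
      for the drop from \<open>\<nu> y\<close> to \<open>\<nu> y'\<close>; in the second,
      \<open>\<Delta> t\<close> is a constant.\<close>
    have "\<nu> u \<le> \<nu> y" unfolding u_def
    proof (rule nu_add_le[OF hom_of_nat_mult[OF h1] hom_of_nat_mult[OF h2]])
      have "\<nu> (\<Delta> t * y) = \<nu> y"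
        using nu_mult[OF der_hom[OF t(1)] xy(2) nz xy(4)] nu_const[OF root_der(1)[OF root nz]] by simp
      then show "of_nat d * (\<Delta> t * y) = 0 \<or> \<nu> (of_nat d * (\<Delta> t * y)) \<le> \<nu> y"
        using nu_of_nat_mult[OF h2, of d] nz xy t(3) by simp
      show "of_nat b * (s * y') = 0 \<or> \<nu> (of_nat b * (s * y')) \<le> \<nu> y"
        using nu_of_nat_mult[OF h1, of b] nu_mult[OF hs y'(1) sn] nuy s(2) w(4)
        by (cases "y' = 0") (auto simp: s_def[symmetric] sn)
    qed
    moreover have "\<nu> u = (a - 1) * \<nu> x + \<nu> v"
      using nu_mult[OF hom_power[OF xy(1)] hv] nu_power[OF xy(1,3)] xy(3) eq False by auto
    ultimately show ?thesis by simp
  next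
    case True
    \<comment> \<open>For \<open>u = 0\<close> the logarithmic derivatives of \<open>s\<close> and
      \<open>y ^ b\<close> agree, so \<open>s\<close> has degree \<open>b * \<nu> y\<close>, at
      least \<open>2 * d\<close>, instead of \<open>d\<close>.\<close>
    have "of_nat b * (s * \<Delta> y) - y * \<Delta> s = t ^ (d - 1) * u"
      using s(1) by (simp add: u_def s_def y' algebra_simps)
    then have eq2: "of_nat b * (s * \<Delta> y) = y * \<Delta> s" using True by simp
    then have dy: "\<Delta> y \<noteq> 0" using ds xy(4) by auto
    have "\<nu> s = b * \<nu> y" using nu_of_log_derivative[OF hs ds xy(2) dy eq2] .
    moreover have "\<nu> y \<ge> d" using nuy dy y'(2) by auto
    ultimately have "d \<ge> 2 * d" using s(2) w(4) by (metis s_def mult_le_mono)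
    then show ?thesis using t(3) by simp
  qed
qed

text \<open>As \<open>z\<close> is constant and \<open>\<nu> t = 1\<close>, the sum
  \<open>x ^ a + y ^ b = - (z ^ c + t ^ d)\<close> has degree \<open>d\<close>. The bounds
  \<open>(a - 1) * \<nu> x \<le> \<nu> y\<close> and \<open>(b - 1) * \<nu> y \<le> \<nu> x\<close>
  force both degrees to vanish, and then the sum would be constant.\<close>

lemma root_power_sum_absurd:
  assumes root: "root_divides t N d" and nz: "\<Delta> t \<noteq> 0"
    and z: "hom wz z" "\<Delta> z = 0" "int c * wz = N * int d"
    and xy: "hom wx x" "hom wy y" "x \<noteq> 0" "y \<noteq> 0" and dvd: "int d dvd wx" "int d dvd wy"
    and w: "int a * wx = N * int d" "int b * wy = N * int d" "a \<ge> 2" "b \<ge> 2" "c \<ge> 1" "a > 2 \<or> b > 2"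
    and rel: "x ^ a + y ^ b + z ^ c + t ^ d = 0"
  shows False
proof -
  have t: "hom N t" "t \<noteq> 0" "d \<ge> 2" using root by (auto simp: root_divides_def)
  have seq: "x ^ a + y ^ b = - (z ^ c + t ^ d)" using rel by (simp add: algebra_simps add_eq_0_iff)
  have hz: "hom (N * int d) (z ^ c)" using hom_power[OF z(1), of c] z(3) by simp
  have ht: "hom (N * int d) (t ^ d)" using hom_power[OF t(1), of d] by (simp add: mult.commute)
  have dz: "\<Delta> (z ^ c) = 0" using der_power[OF z(1), of "c - 1"] z(2) w(5) by simp
  have dt: "\<Delta> (t ^ d) = of_nat d * t ^ (d - 1) * \<Delta> t" using der_power[OF t(1), of "d - 1"] t(3) by simp
  have ds: "\<Delta> (x ^ a + y ^ b) = - of_nat d * t ^ (d - 1) * \<Delta> t"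
    unfolding seq using der_uminus[OF hom_add[OF hz ht]] der_add[OF hz ht] dz dt by simp
  have dsn: "\<Delta> (x ^ a + y ^ b) \<noteq> 0" unfolding ds using t nz by simp
  have hs: "hom (N * int d) (x ^ a + y ^ b)" using hom_add hom_power xy(1,2) w(1,2) by metis
  have "\<nu> (x ^ a + y ^ b) = Suc (\<nu> (\<Delta> (x ^ a + y ^ b)))" using nu_der[OF hs dsn] .
  also have "\<Delta> (x ^ a + y ^ b) = of_nat d * (t ^ (d - 1) * (- \<Delta> t))" using ds by (simp add: mult.assoc)
  also have "\<nu> \<dots> = \<nu> (t ^ (d - 1) * (- \<Delta> t))"
    using nu_of_nat_mult[OF hom_mult[OF hom_power[OF t(1)] hom_uminus[OF der_hom[OF t(1)]]]] t nz by simp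
  also have "\<dots> = d - 1"
    using nu_mult[OF hom_power[OF t(1)] hom_uminus[OF der_hom[OF t(1)]], of "d - 1"] t nz
      nu_power[OF t(1,2)] nu_root[OF root nz] der_uminus[OF der_hom[OF t(1)]] root_der(1)[OF root nz]
      nu_const[of "- \<Delta> t"] by simp
  finally have nus: "\<nu> (x ^ a + y ^ b) = d" using t(3) by simp
  have 1: "(a - 1) * \<nu> x \<le> \<nu> y"
    using root_power_sum_aux[OF root nz xy dvd w(1-4) ds nus] .
  have 2: "(b - 1) * \<nu> y \<le> \<nu> x"
    using root_power_sum_aux[OF root nz xy(2,1,4,3) dvd(2,1) w(2,1,4,3)] ds nus by (simp add: add.commute)
  have "\<nu> x = 0 \<and> \<nu> y = 0"
  proof (cases "a > 2")
    case True
    have "2 * \<nu> x \<le> (a - 1) * \<nu> x" "1 * \<nu> y \<le> (b - 1) * \<nu> y" using True w(4) by (intro mult_le_mono1; simp)+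
    then show ?thesis using 1 2 by linarith
  next
    case False
    have "1 * \<nu> x \<le> (a - 1) * \<nu> x" "2 * \<nu> y \<le> (b - 1) * \<nu> y" using False w by (intro mult_le_mono1; simp)+
    then show ?thesis using 1 2 by linarith
  qed
  then have "\<Delta> x = 0" "\<Delta> y = 0" using nu_eq_0_iff xy by blast+
  moreover have "int a * wx = int b * wy" using w(1,2) by simp
  ultimately show False using dsn der_power_sum[OF xy(1,2), of a b] w(3,4) by simp
qed

text \<open>The roles of \<open>t\<close> and \<open>z\<close> can be exchanged: if one were not
  constant, the other would be by \<open>root_der_exclusive\<close>, and
  \<open>root_power_sum_absurd\<close> applies.\<close>

theorem brieskorn_homogeneous_derivation_zero:
  assumes t: "root_divides t N d" and z: "root_divides z M c"
    and dvd: "int d dvd M" "int c dvd N" "int d dvd wx" "int d dvd wy" "int c dvd wx" "int c dvd wy"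
    and xy: "hom wx x" "hom wy y" "x \<noteq> 0" "y \<noteq> 0"
    and w: "int a * wx = N * int d" "int b * wy = N * int d" "M * int c = N * int d"
      "a \<ge> 2" "b \<ge> 2" "a > 2 \<or> b > 2"
    and rel: "x ^ a + y ^ b + z ^ c + t ^ d = 0" and s: "x ^ a + y ^ b \<noteq> 0"
  shows "\<Delta> x = 0" "\<Delta> y = 0" "\<Delta> z = 0" "\<Delta> t = 0"
proof -
  have ht: "hom N t" "d \<ge> 2" and hz: "hom M z" "c \<ge> 2" using t z by (auto simp: root_divides_def)
  show t0: "\<Delta> t = 0"
  proof (rule ccontr)
    assume nz: "\<Delta> t \<noteq> 0"
    have "int c * M = N * int d" "c \<ge> 1" using w(3) hz by (simp_all add: mult.commute)
    from root_power_sum_absurd[OF t nz hz(1) root_der_exclusive[OF t z dvd(1) nz] this(1) xy dvd(3,4) w(1,2,4,5) this(2) w(6) rel]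
    show False .
  qed
  show z0: "\<Delta> z = 0"
  proof (rule ccontr)
    assume nz: "\<Delta> z \<noteq> 0"
    have "x ^ a + y ^ b + t ^ d + z ^ c = 0" using rel by (simp add: algebra_simps)
    moreover have "int d * N = M * int c" "int a * wx = M * int c" "int b * wy = M * int c" "d \<ge> 1"
      using w(1-3) ht by (simp_all add: mult.commute)
    ultimately show False
      using root_power_sum_absurd[OF z nz ht(1) root_der_exclusive[OF z t dvd(2) nz] _ xy dvd(5,6) _ _ w(4,5) _ w(6)]
      by blast
  qed
  have "hom (N * int d) (z ^ c)" "hom (N * int d) (t ^ d)"
    using hom_power[OF hz(1), of c] hom_power[OF ht(1), of d] w(3) by (simp_all add: mult.commute)
  moreover have "\<Delta> (z ^ c) = 0" "\<Delta> (t ^ d) = 0"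
    using der_power[OF hz(1), of "c - 1"] der_power[OF ht(1), of "d - 1"] z0 t0 hz ht by auto
  moreover have "x ^ a + y ^ b = - (z ^ c + t ^ d)" using rel by (simp add: algebra_simps add_eq_0_iff)
  ultimately have "\<Delta> (x ^ a + y ^ b) = 0" using der_uminus[OF hom_add] der_add by simp
  then show "\<Delta> x = 0" "\<Delta> y = 0" using power_sum_const[OF xy _ w(4,5) _ s] w(1,2) by auto
qed

end

section \<open>The leading homogeneous part of a derivation\<close>

text \<open>Homogeneous elements of the subring generated by the constants \<open>K\<close> and the
  monomials in \<open>gens\<close>, the polynomial variable recording the degree. The inductive form
  allows proofs by checking generators. Only zero is homogeneous of negative degree.\<close>

inductive monom_hom :: "'k::comm_ring_1 set \<Rightarrow> (nat \<times> 'k) set \<Rightarrow> int \<Rightarrow> 'k poly \<Rightarrow> bool" for K gens where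
  zero: "monom_hom K gens n 0"
| const: "c \<in> K \<Longrightarrow> monom_hom K gens 0 [:c:]"
| gen: "(w, u) \<in> gens \<Longrightarrow> monom_hom K gens (int w) (monom u w)"
| add: "monom_hom K gens n p \<Longrightarrow> monom_hom K gens n q \<Longrightarrow> monom_hom K gens n (p + q)"
| mult: "monom_hom K gens m p \<Longrightarrow> monom_hom K gens n q \<Longrightarrow> monom_hom K gens (m + n) (p * q)"

definition graded_span :: "'k::comm_ring_1 set \<Rightarrow> (nat \<times> 'k) set \<Rightarrow> 'k poly set" where
  "graded_span K gens = {p. \<forall>m. monom_hom K gens (int m) (monom (coeff p m) m)}"

text \<open>Integer \<open>n\<close> lets the shift by a possibly negative degree of a derivation be
  written without natural subtraction; components of negative degree are zero.\<close>

definition part :: "int \<Rightarrow> 'k::comm_ring_1 poly \<Rightarrow> 'k poly" where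
  "part n p = (if n \<ge> 0 then monom (coeff p (nat n)) (nat n) else 0)"

lemma part_0 [simp]: "part n 0 = 0"
  by (simp add: part_def)

lemma part_add: "part n (p + q) = part n p + part n q"
  by (simp add: part_def add_monom)

lemma part_eq_0: "(\<And>k. coeff p k \<noteq> 0 \<Longrightarrow> int k \<noteq> n) \<Longrightarrow> part n p = 0"
  unfolding part_def by (metis monom_eq_0 nat_0_le)

lemma monom_hom_form:
  "monom_hom K gens n p \<Longrightarrow> p = 0 \<or> (\<exists>m c. n = int m \<and> p = monom c m)"
proof (induction rule: monom_hom.induct)
  case (const c)
  then show ?case by (metis monom_0 of_nat_0)
next
  case (add n p q)
  then show ?case by (auto simp: add_monom)
next
  case (mult m p n q)
  then show ?case by (auto simp: mult_monom) (metis of_nat_add)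
qed auto

lemma part_monom_hom: "monom_hom K gens n p \<Longrightarrow> part n p = p"
  using monom_hom_form[of K gens n p] by (auto simp: part_def)

lemma part_mult:
  assumes "monom_hom K gens m p"
  shows "part (m + j) (p * q) = p * part j q"
proof -
  have "part (int m' + j) (monom c m' * q) = monom c m' * part j q" for m' c
  proof (cases "j \<ge> 0")
    case True
    then show ?thesis by (simp add: part_def coeff_monom_mult mult_monom nat_add_distrib)
  next
    case False
    then have "coeff (monom c m' * q) k = 0" if "int k = int m' + j" for k
      using that by (simp add: coeff_monom_mult)
    then show ?thesis using False by (auto simp: part_def)
  qed
  then show ?thesis using monom_hom_form[OF assms] by auto
qed

lemma monom_hom_sum:
  "finite A \<Longrightarrow> (\<And>i. i \<in> A \<Longrightarrow> monom_hom K gens n (f i)) \<Longrightarrow> monom_hom K gens n (\<Sum>i\<in>A. f i)"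
  by (induction A rule: finite_induct) (auto intro: monom_hom.zero monom_hom.add)

lemma monom_sum_hom: "monom (\<Sum>i\<in>A. f i) n = (\<Sum>i\<in>A. monom (f i) n)"
  by (induction A rule: infinite_finite_induct) (auto simp: add_monom[symmetric])

lemma graded_span_0: "0 \<in> graded_span K gens"
  by (simp add: graded_span_def monom_hom.zero)

lemma graded_span_add: "p \<in> graded_span K gens \<Longrightarrow> q \<in> graded_span K gens \<Longrightarrow> p + q \<in> graded_span K gens"
  by (simp add: graded_span_def add_monom[symmetric] monom_hom.add)

lemma graded_span_mult:
  assumes "p \<in> graded_span K gens" "q \<in> graded_span K gens"
  shows "p * q \<in> graded_span K gens"
proof -
  have "monom_hom K gens (int n) (monom (coeff p i) i * monom (coeff q (n - i)) (n - i))" if "i \<le> n" for i n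
  proof -
    have "monom_hom K gens (int i) (monom (coeff p i) i)"
      "monom_hom K gens (int (n - i)) (monom (coeff q (n - i)) (n - i))"
      using assms unfolding graded_span_def by blast+
    from monom_hom.mult[OF this] that show ?thesis by (simp add: of_nat_diff)
  qed
  then show ?thesis unfolding graded_span_def mem_Collect_eq coeff_mult monom_sum_hom
    by (intro allI monom_hom_sum) (auto simp: mult_monom)
qed

lemma graded_span_sum:
  "(\<And>i. i \<in> A \<Longrightarrow> f i \<in> graded_span K gens) \<Longrightarrow> (\<Sum>i\<in>A. f i) \<in> graded_span K gens"
  by (induction A rule: infinite_finite_induct) (auto intro: graded_span_0 graded_span_add)

lemma monom_hom_in_graded_span:
  assumes "monom_hom K gens n p"
  shows "p \<in> graded_span K gens"
proof -
  have "monom_hom K gens (int k) (monom (coeff p k) k)" for k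
    using monom_hom_form[OF assms] assms by (cases "int k = n") (auto simp: monom_hom.zero)
  then show ?thesis by (simp add: graded_span_def)
qed

lemma monom_hom_part:
  assumes "p \<in> graded_span K gens"
  shows "monom_hom K gens n (part n p)"
  using assms unfolding part_def graded_span_def by (cases n) (auto simp: monom_hom.zero)

section \<open>Leading part of a derivation on a graded subring\<close>

locale graded_lnd =
  fixes K :: "'k::{idom,ring_char_0} set" and gens :: "(nat \<times> 'k) set" and D :: "'k poly \<Rightarrow> 'k poly"
  assumes one: "1 \<in> K" and minus_one: "-1 \<in> K" and fin: "finite gens"
    and D_closed: "p \<in> graded_span K gens \<Longrightarrow> D p \<in> graded_span K gens"
    and D_add: "p \<in> graded_span K gens \<Longrightarrow> q \<in> graded_span K gens \<Longrightarrow> D (p + q) = D p + D q"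
    and D_mult: "p \<in> graded_span K gens \<Longrightarrow> q \<in> graded_span K gens \<Longrightarrow> D (p * q) = p * D q + D p * q"
    and D_const: "c \<in> K \<Longrightarrow> D [:c:] = 0"
    and D_nil: "p \<in> graded_span K gens \<Longrightarrow> \<exists>n. (D ^^ n) p = 0"
begin

abbreviation "homog \<equiv> monom_hom K gens"
abbreviation "S \<equiv> graded_span K gens"

lemma D_zero: "D 0 = 0"
  using D_add[OF graded_span_0 graded_span_0] by simp

lemma D_sum: "(\<And>i. i \<in> A \<Longrightarrow> f i \<in> S) \<Longrightarrow> D (\<Sum>i\<in>A. f i) = (\<Sum>i\<in>A. D (f i))"
  by (induction A rule: infinite_finite_induct) (auto simp: D_zero D_add graded_span_sum)

lemma D_sum_parts:
  assumes "p \<in> S"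
  shows "D p = (\<Sum>i\<le>degree p. D (monom (coeff p i) i))"
proof -
  have "D (\<Sum>i\<le>degree p. monom (coeff p i) i) = (\<Sum>i\<le>degree p. D (monom (coeff p i) i))"
    using assms by (intro D_sum monom_hom_in_graded_span) (auto simp: graded_span_def)
  then show ?thesis by (simp add: poly_as_sum_of_monoms)
qed

lemma D_eq_0:
  assumes "\<And>w u. (w, u) \<in> gens \<Longrightarrow> D (monom u w) = 0" and "p \<in> S"
  shows "D p = 0"
proof -
  have "D q = 0" if "homog n q" for n q using that
  proof (induction rule: monom_hom.induct)
    case (mult m p n q)
    then show ?case using D_mult[OF monom_hom_in_graded_span monom_hom_in_graded_span, of m p n q] by simp
  next
    case (add n p q)
    then show ?case using D_add[OF monom_hom_in_graded_span monom_hom_in_graded_span, of n p n q] by simp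
  qed (auto simp: D_zero D_const assms)
  then have "D (monom (coeff p i) i) = 0" for i using assms(2) unfolding graded_span_def by blast
  then show ?thesis using D_sum_parts[OF assms(2)] by simp
qed

definition lift_degrees :: "int set" where
  "lift_degrees = (\<Union>(w, u)\<in>gens. (\<lambda>k. int k - int w) ` {k. coeff (D (monom u w)) k \<noteq> 0})"

text \<open>The degree of the leading homogeneous part of \<open>D\<close>. Junk if \<open>D\<close> vanishes on all generators.\<close>
definition e :: int where "e = Max lift_degrees"

text \<open>\<open>degree p\<close> stands in for the homogeneous degree of \<open>p\<close>, with
  which it agrees when \<open>p\<close> is nonzero and homogeneous; for \<open>p = 0\<close> every
  component of \<open>D p\<close> is zero.\<close>

definition \<Delta> :: "'k poly \<Rightarrow> 'k poly" where "\<Delta> p = part (int (degree p) + e) (D p)"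

lemma finite_lift_degrees: "finite lift_degrees"
proof -
  have "finite {k. coeff p k \<noteq> 0}" for p :: "'k poly"
    by (rule finite_subset[of _ "{..degree p}"]) (auto simp: le_degree)
  then show ?thesis unfolding lift_degrees_def using fin by auto
qed

text \<open>The choice of \<open>e\<close> gives the bound on generators, and the Leibniz rule
  propagates it through products.\<close>

lemma D_bound: "homog n p \<Longrightarrow> coeff (D p) k \<noteq> 0 \<Longrightarrow> int k \<le> n + e"
proof (induction arbitrary: k rule: monom_hom.induct)
  case (gen w u)
  then have "int k - int w \<in> lift_degrees" unfolding lift_degrees_def by auto
  then show ?case unfolding e_def using Max_ge[OF finite_lift_degrees] by fastforce
next
  case (add n p q)
  have "D (p + q) = D p + D q" using D_add add.hyps monom_hom_in_graded_span by blast
  then have "coeff (D p) k \<noteq> 0 \<or> coeff (D q) k \<noteq> 0" using add.prems by auto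
  then show ?case using add.IH by blast
next
  case (mult m p n q)
  have *: "int k \<le> m + n + e" if hm: "homog m p" and r: "\<And>k. coeff r k \<noteq> 0 \<Longrightarrow> int k \<le> n + e"
    and nz: "coeff (p * r) k \<noteq> 0" for m n p r
  proof -
    obtain c m' where "m = int m'" "p = monom c m'" using monom_hom_form[OF hm] nz by auto
    then show ?thesis using nz r[of "k - m'"] by (auto simp: coeff_monom_mult split: if_splits)
  qed
  have "coeff (p * D q) k \<noteq> 0 \<or> coeff (q * D p) k \<noteq> 0"
    using mult.prems D_mult[OF monom_hom_in_graded_span monom_hom_in_graded_span] mult.hyps
    by (auto simp: mult.commute)
  then show ?case using *[OF mult.hyps(1) mult.IH(2)] *[OF mult.hyps(2) mult.IH(1)] by (auto simp: algebra_simps)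
qed (auto simp: D_zero D_const)

lemma \<Delta>_eq: "homog n p \<Longrightarrow> \<Delta> p = part (n + e) (D p)"
  using monom_hom_form[of K gens n p] by (cases "p = 0") (auto simp: \<Delta>_def D_zero degree_monom_eq)

lemma D_bound_span:
  assumes "p \<in> S" "\<And>k. coeff p k \<noteq> 0 \<Longrightarrow> int k \<le> M" "coeff (D p) k \<noteq> 0"
  shows "int k \<le> M + e"
proof -
  have "(\<Sum>i\<le>degree p. coeff (D (monom (coeff p i) i)) k) \<noteq> 0"
    using assms(3) D_sum_parts[OF assms(1)] by (simp add: coeff_sum)
  then obtain i where i: "coeff (D (monom (coeff p i) i)) k \<noteq> 0"
    by (meson sum.neutral)
  then have "coeff p i \<noteq> 0" by (auto simp: D_zero)
  moreover have "int k \<le> int i + e" using D_bound[OF _ i] assms(1) by (simp add: graded_span_def)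
  ultimately show ?thesis using assms(2)[of i] by linarith
qed

text \<open>Components of \<open>p\<close> below degree \<open>M\<close> contribute to
  \<open>D p\<close> only below degree \<open>M + e\<close>, so the top of \<open>D p\<close>
  depends on the top of \<open>p\<close> alone.\<close>

lemma part_D_top:
  assumes p: "p \<in> S" and M: "\<And>k. coeff p k \<noteq> 0 \<Longrightarrow> int k \<le> M"
  shows "part (M + e) (D p) = \<Delta> (part M p)"
proof -
  define q where "q = p + [:-1:] * part M p"
  have pS: "part M p \<in> S" using monom_hom_in_graded_span monom_hom_part p by blast
  have "[:-1:] \<in> S" using monom_hom_in_graded_span monom_hom.const minus_one by blast
  then have qS: "q \<in> S" unfolding q_def using p pS by (intro graded_span_add graded_span_mult)
  have q: "int k \<le> M - 1" if "coeff q k \<noteq> 0" for k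
    using that M[of k] by (cases "int k = M") (auto simp: q_def part_def split: if_splits)
  have "p = part M p + q" by (simp add: q_def)
  then have "D p = D (part M p) + D q" using D_add[OF pS qS] by simp
  moreover have "part (M + e) (D q) = 0"
    using D_bound_span[OF qS q] by (intro part_eq_0) fastforce
  ultimately show ?thesis using \<Delta>_eq[OF monom_hom_part[OF p]] by (simp add: part_add)
qed

text \<open>Powers of \<open>\<Delta>\<close> are the extreme components of powers of
  \<open>D\<close>; this passes local nilpotency from \<open>D\<close> to
  \<open>\<Delta>\<close>.\<close>

lemma iter_D_top:
  assumes "homog n p"
  shows "(D ^^ i) p \<in> S \<and> (\<forall>k. coeff ((D ^^ i) p) k \<noteq> 0 \<longrightarrow> int k \<le> n + int i * e) \<and>
    part (n + int i * e) ((D ^^ i) p) = (\<Delta> ^^ i) p"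
proof (induction i)
  case 0
  have "coeff p k \<noteq> 0 \<longrightarrow> int k \<le> n" for k using monom_hom_form[OF assms] by (auto split: if_splits)
  then show ?case using monom_hom_in_graded_span[OF assms] part_monom_hom[OF assms] by simp
next
  case (Suc i)
  let ?p = "(D ^^ i) p" and ?M = "n + int i * e"
  have M: "n + int (Suc i) * e = ?M + e" by (simp add: algebra_simps)
  have p: "?p \<in> S" and bound: "\<And>k. coeff ?p k \<noteq> 0 \<Longrightarrow> int k \<le> ?M"
    and top: "part ?M ?p = (\<Delta> ^^ i) p" using Suc by auto
  show ?case unfolding M
    using D_closed[OF p] D_bound_span[OF p bound] part_D_top[OF p bound] top by simp
qed

lemma homogeneous_lnd_top: "homogeneous_lnd homog \<Delta> e"
proof
  fix n m u v
  show "homog n 0" by (rule monom_hom.zero)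
  show "homog 0 1" using monom_hom.const[OF one] by (simp add: one_pCons)
  show "homog 0 (-1)" using monom_hom.const[OF minus_one] by (simp add: one_pCons)
  show "homog n u \<Longrightarrow> homog n v \<Longrightarrow> homog n (u + v)" by (rule monom_hom.add)
  show "homog m u \<Longrightarrow> homog n v \<Longrightarrow> homog (m + n) (u * v)" by (rule monom_hom.mult)
  show "homog n u \<Longrightarrow> homog (n + e) (\<Delta> u)"
    using \<Delta>_eq monom_hom_part D_closed monom_hom_in_graded_span by metis
  show "homog n u \<Longrightarrow> homog n v \<Longrightarrow> \<Delta> (u + v) = \<Delta> u + \<Delta> v"
    using \<Delta>_eq[OF monom_hom.add] \<Delta>_eq D_add[OF monom_hom_in_graded_span monom_hom_in_graded_span]
    by (simp add: part_add)
  show "\<Delta> (u * v) = u * \<Delta> v + \<Delta> u * v" if u: "homog m u" and v: "homog n v"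
  proof -
    have "\<Delta> (u * v) = part (m + (n + e)) (u * D v) + part (n + (m + e)) (v * D u)"
      using \<Delta>_eq[OF monom_hom.mult[OF u v]] D_mult monom_hom_in_graded_span[OF u] monom_hom_in_graded_span[OF v]
      by (simp add: part_add algebra_simps)
    then show ?thesis using part_mult[OF u] part_mult[OF v] \<Delta>_eq[OF u] \<Delta>_eq[OF v] by (simp add: mult.commute)
  qed
  show "\<exists>k. (\<Delta> ^^ k) u = 0" if "homog n u"
    using D_nil[OF monom_hom_in_graded_span[OF that]] iter_D_top[OF that] by (metis part_0)
qed

text \<open>A nonzero \<open>D\<close> is nonzero on some generator, so the maximum \<open>e\<close>
  is taken over a nonempty finite set and is attained; the leading part does not vanish on a
  generator attaining it.\<close>

lemma \<Delta>_nonzero: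
  assumes "p \<in> S" "D p \<noteq> 0"
  shows "\<exists>w u. (w, u) \<in> gens \<and> \<Delta> (monom u w) \<noteq> 0"
proof -
  obtain w u where wu: "(w, u) \<in> gens" "D (monom u w) \<noteq> 0" using D_eq_0 assms by blast
  then have "int (degree (D (monom u w))) - int w \<in> lift_degrees" unfolding lift_degrees_def
    using leading_coeff_neq_0[OF wu(2)] by blast
  then have "lift_degrees \<noteq> {}" by blast
  then have "e \<in> lift_degrees" unfolding e_def using Max_in finite_lift_degrees by blast
  then obtain w u k where wu: "(w, u) \<in> gens" "coeff (D (monom u w)) k \<noteq> 0" "e = int k - int w"
    unfolding lift_degrees_def by auto
  then have "\<Delta> (monom u w) = monom (coeff (D (monom u w)) k) k"
    using \<Delta>_eq[OF monom_hom.gen[OF wu(1)]] by (simp add: part_def)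
  then show ?thesis using wu by (metis monom_eq_0_iff)
qed

end

text \<open>Since the other generators have degree divisible by \<open>d\<close>, the degree
  \<open>n\<close> fixes the exponent of the generator \<open>monom t N\<close> modulo
  \<open>d\<close>; induction on generation avoids monomial normal forms.\<close>

lemma monom_hom_root_dvd:
  assumes one: "1 \<in> K" and t: "(N, t) \<in> gens" and d: "d \<ge> 2" and cop: "coprime (int N) (int d)"
    and others: "\<And>w u. (w, u) \<in> gens \<Longrightarrow> (w, u) = (N, t) \<or> d dvd w"
  shows "monom_hom K gens n p \<Longrightarrow> j < d \<Longrightarrow> int d dvd n - int N * int j \<Longrightarrow>
    \<exists>v. monom_hom K gens (n - int N * int j) v \<and> p = monom t N ^ j * v"
proof (induction arbitrary: j rule: monom_hom.induct)
  case (zero n)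
  then show ?case by (intro exI[of _ 0]) (simp add: monom_hom.zero)
next
  case (const c)
  then have "int d dvd int N * int j" by simp
  then have "d dvd j" using dvd_of_dvd_mult_coprime[OF cop] int_dvd_int_iff by blast
  then have "j = 0" using const by (auto dest: dvd_imp_le)
  then show ?case using const by (intro exI[of _ "[:c:]"]) (simp add: monom_hom.const)
next
  case (gen w u)
  consider "(w, u) = (N, t)" | "d dvd w" using others gen by blast
  then show ?case
  proof cases
    case 1
    then have "int d dvd int N * (1 - int j)" using gen by (simp add: algebra_simps)
    then have dv: "int d dvd int j - 1" using dvd_of_dvd_mult_coprime[OF cop] by (metis dvd_minus_iff minus_diff_eq)
    have "j = 1"
    proof (cases j)
      case 0 then show ?thesis using dv d by (auto dest: zdvd_imp_le)
    next
      case (Suc i)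
      then have "d dvd i" using dv by simp
      then show ?thesis using Suc gen by (auto dest: dvd_imp_le)
    qed
    then show ?thesis using 1 monom_hom.const[OF one, of gens]
      by (intro exI[of _ 1]) (simp add: one_pCons)
  next
    case 2
    then have "int d dvd int w" by simp
    then have "int d dvd int w - (int w - int N * int j)" using gen.prems(2) by (rule dvd_diff)
    then have "int d dvd int N * int j" by simp
    then have "d dvd j" using dvd_of_dvd_mult_coprime[OF cop] int_dvd_int_iff by blast
    then have "j = 0" using gen by (auto dest: dvd_imp_le)
    then show ?thesis using gen by (intro exI[of _ "monom u w"]) (simp add: monom_hom.gen)
  qed
next
  case (add n p q)
  obtain u v where "monom_hom K gens (n - int N * int j) u" "p = monom t N ^ j * u"
     "monom_hom K gens (n - int N * int j) v" "q = monom t N ^ j * v" using add by meson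
  then show ?case by (intro exI[of _ "u + v"]) (simp add: monom_hom.add algebra_simps)
next
  case (mult m p n q)
  obtain j1 j2 where j1: "j1 < d" "int d dvd m - int N * int j1" and j2: "j2 < d" "int d dvd n - int N * int j2"
    using coprime_residue[OF cop] d by (metis less_le_trans pos2)
  obtain u v where u: "monom_hom K gens (m - int N * int j1) u" "p = monom t N ^ j1 * u"
    and v: "monom_hom K gens (n - int N * int j2) v" "q = monom t N ^ j2 * v" using mult.IH j1 j2 by meson
  have "int d dvd (m + n - int N * int j) - (m - int N * int j1) - (n - int N * int j2)"
    by (rule dvd_diff[OF dvd_diff[OF mult.prems(2) j1(2)] j2(2)])
  then have "int d dvd int N * (int j1 + int j2 - int j)" by (simp add: algebra_simps)
  then have dv: "int d dvd int j1 + int j2 - int j" using dvd_of_dvd_mult_coprime[OF cop] by blast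
  \<comment> \<open>The exponents forced on the factors add up to \<open>j\<close> modulo
    \<open>d\<close>; as \<open>j < d\<close>, their sum is at least \<open>j\<close>, and the
    surplus \<open>i\<close> goes into the cofactor.\<close>
  have "j \<le> j1 + j2"
  proof (rule ccontr)
    assume "\<not> j \<le> j1 + j2"
    then have "0 < int j - int j1 - int j2" "int j - int j1 - int j2 < int d" using mult.prems by linarith+
    moreover have "int d dvd int j - int j1 - int j2" using dv by (metis dvd_minus_iff minus_diff_eq diff_diff_eq)
    ultimately show False by (auto dest: zdvd_imp_le)
  qed
  then obtain i where i: "j1 + j2 = j + i" by (metis le_iff_add)
  have pow: "monom_hom K gens (int N * int k) (monom t N ^ k)" for k
  proof (induction k)
    case 0 show ?case using monom_hom.const[OF one, of gens] by (simp add: one_pCons)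
  next
    case (Suc k) then show ?case using monom_hom.mult[OF monom_hom.gen[OF t] Suc] by (simp add: algebra_simps)
  qed
  have "monom_hom K gens (int N * int i + ((m - int N * int j1) + (n - int N * int j2))) (monom t N ^ i * (u * v))"
    using pow u v by (intro monom_hom.mult)
  moreover have "int N * int i + ((m - int N * int j1) + (n - int N * int j2)) = m + n - int N * int j"
  proof -
    have *: "int i = int j1 + int j2 - int j" using i by linarith
    show ?thesis unfolding * by (simp add: algebra_simps)
  qed
  moreover have "p * q = monom t N ^ j * (monom t N ^ i * (u * v))"
  proof -
    have "p * q = monom t N ^ (j1 + j2) * (u * v)" unfolding u v power_add by (simp only: ac_simps)
    then show ?thesis unfolding i power_add by (simp only: ac_simps)
  qed
  ultimately show ?case by auto
qed

section \<open>Embedding the hypersurface ring in a polynomial ring\<close>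

definition ring_map :: "('a::comm_ring_1 \<Rightarrow> 'b::comm_ring_1) \<Rightarrow> bool" where
  "ring_map h \<longleftrightarrow> h 1 = 1 \<and> (\<forall>u v. h (u + v) = h u + h v) \<and> (\<forall>u v. h (u * v) = h u * h v)"

lemma ring_mapD:
  assumes "ring_map h"
  shows "h 1 = 1" "h (u + v) = h u + h v" "h (u * v) = h u * h v" "h 0 = 0" "h (u ^ k) = h u ^ k"
proof -
  show "h 1 = 1" and add: "h (u + v) = h u + h v" and mult: "h (u * v) = h u * h v" for u v
    using assms by (auto simp: ring_map_def)
  show "h 0 = 0" using add[of 0 0] by simp
  show "h (u ^ k) = h u ^ k" by (induction k) (auto simp: mult \<open>h 1 = 1\<close>)
qed

lemma ring_map_comp: "ring_map h \<Longrightarrow> ring_map k \<Longrightarrow> ring_map (\<lambda>u. h (k u))"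
  by (simp add: ring_map_def)

lemma ring_map_diff: "ring_map h \<Longrightarrow> h (u - v) = h u - h v"
  using ring_mapD(2)[of h "u - v" v] by simp

definition ev :: "('a::comm_ring_1 \<Rightarrow> 'b::comm_ring_1) \<Rightarrow> 'b \<Rightarrow> 'a poly \<Rightarrow> 'b" where
  "ev h x p = poly (map_poly h p) x"

lemma ev_pCons: "ring_map h \<Longrightarrow> ev h x (pCons a p) = h a + x * ev h x p"
  by (simp add: ev_def map_poly_pCons ring_mapD)

lemma ev_0: "ring_map h \<Longrightarrow> ev h x 0 = 0"
  by (simp add: ev_def)

lemma ev_const: "ring_map h \<Longrightarrow> ev h x [:c:] = h c"
  by (simp add: ev_pCons ev_0)

lemma ev_var: "ring_map h \<Longrightarrow> ev h x [:0, 1:] = x"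
  by (simp add: ev_pCons ev_0 ring_mapD)

lemma ring_map_ev:
  assumes h: "ring_map h"
  shows "ring_map (ev h x)"
proof -
  have add: "ev h x (p + q) = ev h x p + ev h x q" for p q
    by (induction p q rule: poly_induct2) (simp_all add: ev_pCons[OF h] ev_0[OF h] ring_mapD[OF h] algebra_simps)
  have smult: "ev h x (smult a p) = h a * ev h x p" for a p
    by (induction p) (simp_all add: ev_pCons[OF h] ev_0[OF h] ring_mapD[OF h] algebra_simps)
  have mult: "ev h x (p * q) = ev h x p * ev h x q" for p q
    by (induction p) (simp_all add: ev_pCons[OF h] ev_0[OF h] ring_mapD[OF h] add smult algebra_simps)
  show ?thesis using add mult ev_const[OF h, of x 1] by (simp add: ring_map_def ring_mapD[OF h] one_pCons)
qed

lemma ring_map_ev_comp: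
  assumes "ring_map \<phi>" "ring_map h"
  shows "\<phi> (ev h x p) = ev (\<lambda>u. \<phi> (h u)) (\<phi> x) p"
  by (induction p) (simp_all add: ev_pCons ev_0 ring_map_comp assms ring_mapD[OF assms(1)])

lemma ev_altdef:
  assumes "ring_map h" "degree p \<le> n"
  shows "ev h x p = (\<Sum>i\<le>n. h (coeff p i) * x ^ i)"
proof -
  have "degree (map_poly h p) \<le> n"
    using assms(2) by (intro degree_le) (simp add: coeff_map_poly ring_mapD[OF assms(1)] coeff_eq_0)
  then have "poly (\<Sum>i\<le>n. monom (coeff (map_poly h p) i) i) x = ev h x p"
    unfolding ev_def by (simp add: poly_as_sum_of_monoms')
  then show ?thesis by (simp add: poly_sum poly_monom coeff_map_poly ring_mapD[OF assms(1)])
qed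

lemma poly_gen_induct:
  assumes "\<And>c. P [:c:]" "P [:0, 1:]" "\<And>p q. P p \<Longrightarrow> P q \<Longrightarrow> P (p + q)" "\<And>p q. P p \<Longrightarrow> P q \<Longrightarrow> P (p * q)"
  shows "P (p :: 'a::comm_ring_1 poly)"
proof (induction p)
  case 0 show ?case using assms(1)[of 0] by simp
next
  case (pCons a p)
  have "pCons a p = [:a:] + [:0, 1:] * p" by simp
  then show ?case using assms pCons by metis
qed

section \<open>Polynomials in three and four variables\<close>

type_synonym mpoly3 = "complex poly poly poly"

definition X3 :: mpoly3 where "X3 = [:0, 1:]"
definition Y3 :: mpoly3 where "Y3 = [:[:0, 1:]:]"
definition Z3 :: mpoly3 where "Z3 = [:[:[:0, 1:]:]:]"
definition const3 :: "complex \<Rightarrow> mpoly3" where "const3 c = [:[:[:c:]:]:]"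

lemma const_poly_add: "[:a + b:] = [:a:] + [:b :: 'a::comm_ring_1:]"
  and const_poly_mult: "[:a * b:] = [:a:] * [:b :: 'a::comm_ring_1:]" by simp_all

lemma mpoly3_induct:
  assumes "\<And>c. P (const3 c)" "P X3" "P Y3" "P Z3"
    and "\<And>p q. P p \<Longrightarrow> P q \<Longrightarrow> P (p + q)" "\<And>p q. P p \<Longrightarrow> P q \<Longrightarrow> P (p * q)"
  shows "P p"
  apply (rule poly_gen_induct[of P])
     apply (rule_tac P="\<lambda>c. P [:c:]" in poly_gen_induct)
        apply (rule_tac P="\<lambda>c. P [:[:c:]:]" in poly_gen_induct)
  using assms by (auto simp only: X3_def Y3_def Z3_def const3_def const_poly_add const_poly_mult)

lemma mpoly4_induct:
  assumes "\<And>c. P (constC c)" "P varX" "P varY" "P varZ" "P varT"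
    and "\<And>p q. P p \<Longrightarrow> P q \<Longrightarrow> P (p + q)" "\<And>p q. P p \<Longrightarrow> P q \<Longrightarrow> P (p * q)"
  shows "P p"
  apply (rule poly_gen_induct[of P])
     apply (rule_tac P="\<lambda>c. P [:c:]" in poly_gen_induct)
        apply (rule_tac P="\<lambda>c. P [:[:c:]:]" in poly_gen_induct)
           apply (rule_tac P="\<lambda>c. P [:[:[:c:]:]:]" in poly_gen_induct)
  using assms by (auto simp only: varX_def varY_def varZ_def varT_def constC_def const_poly_add const_poly_mult)

definition eval3 where "eval3 h x y z = ev (ev (ev h z) y) x"
definition eval4 where "eval4 h x y z t = ev (ev (ev (ev h t) z) y) x"

lemma ring_map_eval3: "ring_map h \<Longrightarrow> ring_map (eval3 h x y z)"
  by (simp add: eval3_def ring_map_ev)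

lemma ring_map_eval4: "ring_map h \<Longrightarrow> ring_map (eval4 h x y z t)"
  by (simp add: eval4_def ring_map_ev)

lemma eval3_simps:
  assumes "ring_map h"
  shows "eval3 h x y z (const3 k) = h k" "eval3 h x y z X3 = x" "eval3 h x y z Y3 = y" "eval3 h x y z Z3 = z"
  by (simp_all add: eval3_def X3_def Y3_def Z3_def const3_def ev_const ev_var ring_map_ev assms)

lemma eval4_simps:
  assumes "ring_map h"
  shows "eval4 h x y z t (constC k) = h k" "eval4 h x y z t varX = x" "eval4 h x y z t varY = y"
    "eval4 h x y z t varZ = z" "eval4 h x y z t varT = t"
  by (simp_all add: eval4_def varX_def varY_def varZ_def varT_def constC_def ev_const ev_var ring_map_ev assms)

lemma ring_map_mpoly3_eqI:
  assumes "ring_map h" "ring_map k" "\<And>c. h (const3 c) = k (const3 c)" "h X3 = k X3" "h Y3 = k Y3" "h Z3 = k Z3"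
  shows "h p = k p"
  by (induction p rule: mpoly3_induct) (simp_all add: assms(3-6) ring_mapD[OF assms(1)] ring_mapD[OF assms(2)])

lemma ring_map_constC: "ring_map constC" and ring_map_const3: "ring_map const3"
  by (simp_all add: ring_map_def constC_def const3_def one_pCons)

lemma coeff_pcompose_monom:
  fixes p :: "'a::idom poly"
  assumes "d > 0"
  shows "coeff (pcompose p (monom h d)) (d * j) = coeff p j * h ^ j"
proof (induction p arbitrary: j)
  case (pCons a p)
  then show ?case using assms
    by (cases j) (simp_all add: pcompose_pCons coeff_monom_mult coeff_pCons ac_simps split: nat.split)
qed simp

lemma coeff_pcompose_monom_eq_0:
  fixes p :: "'a::idom poly"
  shows "\<not> d dvd k \<Longrightarrow> coeff (pcompose p (monom h d)) k = 0"
proof (induction p arbitrary: k)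
  case (pCons a p)
  then have "k \<noteq> 0" by (auto intro: ccontr)
  moreover have "\<not> d dvd k - d" if "d \<le> k" using pCons.prems that by (simp add: dvd_minus_self)
  ultimately show ?case using pCons.IH[of "k - d"]
    by (simp add: pcompose_pCons coeff_monom_mult coeff_pCons split: nat.split)
qed simp

section \<open>The embedding, its kernel and its image\<close>

locale brieskorn_embedding =
  fixes a b c d m n :: nat
  assumes ge2: "a \<ge> 2" "b \<ge> 2" "c \<ge> 2" "d \<ge> 2" and mn: "a * b * c * m + 1 = d * n"
begin

definition f3 :: mpoly3 where "f3 = X3 ^ a + Y3 ^ b + Z3 ^ c"
text \<open>Scaling a point \<open>(X3, Y3, Z3)\<close> with the weights \<open>b c, a c, a b\<close> by \<open>(- f3) ^ m\<close> multiplies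
  \<open>- f3\<close> by its power with exponent \<open>a b c m\<close>, which turns it into a \<open>d\<close>-th power. This embeds the
  hypersurface ring in a polynomial ring; the additional variable of \<open>\<phi>\<close> records the degree.\<close>
definition x :: mpoly3 where "x = X3 * (- f3) ^ (m * (b * c))"
definition y :: mpoly3 where "y = Y3 * (- f3) ^ (m * (a * c))"
definition z :: mpoly3 where "z = Z3 * (- f3) ^ (m * (a * b))"
definition t :: mpoly3 where "t = (- f3) ^ n"

definition \<phi> :: "mpoly4 \<Rightarrow> mpoly3 poly" where
  "\<phi> = eval4 (\<lambda>k. [:const3 k:]) (monom x (b * c * d)) (monom y (a * c * d)) (monom z (a * b * d)) (monom t (a * b * c))"

definition F :: mpoly4 where "F = varX ^ a + varY ^ b + varZ ^ c + varT ^ d"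

definition gens :: "(nat \<times> mpoly3) set" where
  "gens = {(b * c * d, x), (a * c * d, y), (a * b * d, z), (a * b * c, t)}"

lemma ring_map_const: "ring_map (\<lambda>k. [:const3 k:])"
  using ring_map_const3 by (simp add: ring_map_def one_pCons)

lemma ring_map_phi: "ring_map \<phi>"
  unfolding \<phi>_def by (rule ring_map_eval4[OF ring_map_const])

lemmas phi_hom = ring_mapD[OF ring_map_phi]

lemma phi_simps:
  "\<phi> (constC k) = [:const3 k:]" "\<phi> varX = monom x (b * c * d)" "\<phi> varY = monom y (a * c * d)"
  "\<phi> varZ = monom z (a * b * d)" "\<phi> varT = monom t (a * b * c)"
  unfolding \<phi>_def by (simp_all add: eval4_simps[OF ring_map_const])

lemma powers:
  "x ^ a = X3 ^ a * (- f3) ^ (a * b * c * m)" "y ^ b = Y3 ^ b * (- f3) ^ (a * b * c * m)"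
  "z ^ c = Z3 ^ c * (- f3) ^ (a * b * c * m)" "t ^ d = (- f3) ^ (a * b * c * m + 1)"
  unfolding x_def y_def z_def t_def mn
  by (simp_all add: power_mult_distrib power_mult[symmetric] ac_simps)

text \<open>The first three powers sum to \<open>f3 * (- f3) ^ (a * b * c * m)\<close>, which is the
  negative of \<open>(- f3) ^ (a * b * c * m + 1)\<close>, that is of \<open>t ^ d\<close>.\<close>

lemma relation: "x ^ a + y ^ b + z ^ c + t ^ d = 0"
  unfolding powers power_add by (simp add: f3_def algebra_simps)

lemma ring_map_id: "ring_map (\<lambda>k::complex. k)"
  by (simp add: ring_map_def)

lemma nonzero: "X3 ^ a + Y3 ^ b \<noteq> 0" "f3 \<noteq> 0" "X3 \<noteq> 0" "Y3 \<noteq> 0" "Z3 \<noteq> 0"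
proof -
  \<comment> \<open>Both sums of powers take the value 1 at the point (1, 0, 0).\<close>
  have r: "ring_map (eval3 (\<lambda>k::complex. k) 1 0 0)" using ring_map_eval3 ring_map_id .
  have "eval3 (\<lambda>k::complex. k) 1 0 0 (X3 ^ a + Y3 ^ b) = 1" "eval3 (\<lambda>k::complex. k) 1 0 0 f3 = 1"
    using ge2 by (simp_all add: f3_def ring_mapD[OF r] eval3_simps[OF ring_map_id] power_0_left)
  then show "X3 ^ a + Y3 ^ b \<noteq> 0" "f3 \<noteq> 0" using ring_mapD(4)[OF r] by auto
qed (simp_all add: X3_def Y3_def Z3_def)

lemma xyzt_nonzero: "x \<noteq> 0" "y \<noteq> 0" "z \<noteq> 0" "t \<noteq> 0" "x ^ a + y ^ b \<noteq> 0"
proof -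
  have "x ^ a + y ^ b = (X3 ^ a + Y3 ^ b) * (- f3) ^ (a * b * c * m)" by (simp add: powers algebra_simps)
  then show "x ^ a + y ^ b \<noteq> 0" using nonzero by simp
qed (simp_all add: x_def y_def z_def t_def nonzero)

lemma phi_F: "\<phi> F = 0"
proof -
  have "\<phi> F = monom (x ^ a + y ^ b + z ^ c + t ^ d) (a * b * c * d)"
    by (simp add: F_def phi_hom phi_simps monom_power add_monom[symmetric] ac_simps)
  then show ?thesis by (simp add: relation)
qed

lemma coprime_abc_d: "coprime (int (a * b * c)) (int d)"
proof -
  have "coprime (a * b * c) d"
  proof (rule coprimeI)
    fix k assume k: "k dvd a * b * c" "k dvd d"
    then have "k dvd a * b * c * m + 1" "k dvd a * b * c * m" using mn by auto
    then show "is_unit k" by (simp only: dvd_add_right_iff)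
  qed
  then show ?thesis by (simp only: coprime_int_iff)
qed

text \<open>In \<open>mpoly4\<close> the variable \<open>varT\<close> is innermost, but division by
  \<open>F\<close> needs it as main variable. \<open>\<iota>\<close> embeds C[X, Y, Z], and
  \<open>ev \<iota> varT\<close> reads polynomials in \<open>varT\<close> over that ring.\<close>

definition \<iota> :: "mpoly3 \<Rightarrow> mpoly4" where "\<iota> = eval3 constC varX varY varZ"

lemma ring_map_iota: "ring_map \<iota>"
  unfolding \<iota>_def by (rule ring_map_eval3[OF ring_map_constC])

lemma iota_simps: "\<iota> (const3 k) = constC k" "\<iota> X3 = varX" "\<iota> Y3 = varY" "\<iota> Z3 = varZ"
  unfolding \<iota>_def by (simp_all add: eval3_simps[OF ring_map_constC])

lemma as_poly_in_T: "\<exists>p. u = ev \<iota> varT p"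
proof (induction u rule: mpoly4_induct)
  case (6 u v)
  then show ?case by (metis ring_mapD(2)[OF ring_map_ev[OF ring_map_iota]])
next
  case (7 u v)
  then show ?case by (metis ring_mapD(3)[OF ring_map_ev[OF ring_map_iota]])
qed (metis ev_const[OF ring_map_iota] ev_var[OF ring_map_iota] iota_simps)+

text \<open>The weighted grading of C[X, Y, Z]: the coefficients of \<open>\<Gamma> p\<close> are
  the homogeneous components of \<open>p\<close>. Setting the new variable to 1 recovers
  \<open>p\<close>, so \<open>\<Gamma>\<close> is injective.\<close>

definition \<Gamma> :: "mpoly3 \<Rightarrow> mpoly3 poly" where
  "\<Gamma> = eval3 (\<lambda>k. [:const3 k:]) (monom X3 (b * c)) (monom Y3 (a * c)) (monom Z3 (a * b))"

lemma ring_map_Gamma: "ring_map \<Gamma>"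
  unfolding \<Gamma>_def by (rule ring_map_eval3[OF ring_map_const])

lemma Gamma_simps: "\<Gamma> (const3 k) = [:const3 k:]" "\<Gamma> X3 = monom X3 (b * c)" "\<Gamma> Y3 = monom Y3 (a * c)"
  "\<Gamma> Z3 = monom Z3 (a * b)"
  unfolding \<Gamma>_def by (simp_all add: eval3_simps[OF ring_map_const])

lemma poly_Gamma_1: "poly (\<Gamma> p) 1 = p"
  by (rule ring_map_mpoly3_eqI[of "\<lambda>p. poly (\<Gamma> p) 1" "\<lambda>p. p"])
    (simp_all add: ring_map_def ring_mapD[OF ring_map_Gamma] Gamma_simps poly_monom)

lemma pcompose_monom_monom: "pcompose (monom (u :: mpoly3) i) (monom h j) = monom (u * h ^ i) (i * j)"
proof -
  have "pcompose (monom u i) (monom h j) = smult u (monom h j ^ i)"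
    by (induction i) (simp_all add: monom_0 monom_Suc pcompose_pCons)
  then show ?thesis by (simp add: monom_power smult_monom ac_simps)
qed

text \<open>On polynomials free of \<open>varT\<close>, \<open>\<phi>\<close> is the grading map
  with its variable s replaced by (- f3)^m s^d; in particular only degrees divisible by
  \<open>d\<close> occur.\<close>

lemma phi_iota: "\<phi> (\<iota> p) = pcompose (\<Gamma> p) (monom ((- f3) ^ m) d)"
proof (rule ring_map_mpoly3_eqI[of "\<lambda>p. \<phi> (\<iota> p)"])
  show "ring_map (\<lambda>p. \<phi> (\<iota> p))" using ring_map_comp ring_map_phi ring_map_iota by blast
  show "ring_map (\<lambda>p. pcompose (\<Gamma> p) (monom ((- f3) ^ m) d))"
    by (simp add: ring_map_def ring_mapD[OF ring_map_Gamma] pcompose_add pcompose_mult pcompose_1)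
qed (simp_all add: iota_simps phi_simps Gamma_simps pcompose_monom_monom x_def y_def z_def power_mult[symmetric] ac_simps)

text \<open>Divide \<open>u\<close> by \<open>F\<close>, monic of degree \<open>d\<close> in
  \<open>varT\<close>. In the image of the remainder, the terms with exponents \<open>i < d\<close>
  of \<open>varT\<close> occupy degrees congruent to \<open>a * b * c * i\<close>, distinct modulo
  \<open>d\<close>, so they cannot cancel and each vanishes.\<close>

lemma phi_eq_0_imp_dvd:
  assumes "\<phi> u = 0"
  shows "F dvd u"
proof -
  note evT = ring_mapD[OF ring_map_ev[OF ring_map_iota, of varT]]
  define G :: "mpoly3 poly" where "G = monom 1 d + [:f3:]"
  have degG: "degree G = d" "lead_coeff G = 1"
  proof -
    have "degree [:f3:] < degree (monom (1 :: mpoly3) d)" using ge2 by (simp add: degree_monom_eq)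
    then show "degree G = d" by (simp add: G_def degree_add_eq_left degree_monom_eq)
    then show "lead_coeff G = 1" using ge2 by (simp add: G_def coeff_pCons split: nat.split)
  qed
  have "monom (1::mpoly3) d = [:0, 1:] ^ d" by (simp add: monom_altdef)
  then have FG: "F = ev \<iota> varT G"
    by (simp add: G_def F_def evT ev_const[OF ring_map_iota] ev_var[OF ring_map_iota] f3_def
      ring_mapD[OF ring_map_iota] iota_simps ac_simps)
  obtain p where p: "u = ev \<iota> varT p" using as_poly_in_T by blast
  \<comment> \<open>The coefficients do not form a field, but \<open>G\<close> has leading
    coefficient 1, so pseudo-division is division with remainder.\<close>
  obtain q r where qr: "pseudo_divmod p G = (q, r)" by (cases "pseudo_divmod p G")
  have "G \<noteq> 0" using degG ge2 by auto
  from pseudo_divmod[OF this qr] have r: "p = G * q + r" "r = 0 \<or> degree r < d"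
    using degG by auto
  have deg_r: "degree r \<le> d - 1" using r(2) by auto
  have u: "u = F * ev \<iota> varT q + ev \<iota> varT r" unfolding p FG by (subst r(1)) (simp add: evT)
  let ?N = "a * b * c"
  have "0 = \<phi> (ev \<iota> varT r)" using assms u by (simp add: phi_hom phi_F)
  also have "\<dots> = (\<Sum>i\<le>d - 1. \<phi> (\<iota> (coeff r i)) * monom t ?N ^ i)"
    using ev_altdef[OF ring_map_comp[OF ring_map_phi ring_map_iota] deg_r] ring_map_ev_comp[OF ring_map_phi ring_map_iota]
    by (simp add: phi_simps)
  finally have sum0: "(\<Sum>i\<le>d - 1. monom (t ^ i) (?N * i) * pcompose (\<Gamma> (coeff r i)) (monom ((- f3) ^ m) d)) = 0"
    by (simp add: phi_iota monom_power mult.commute)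
  have "coeff r i = 0" if "i \<le> d - 1" for i
  proof -
    have "coeff (\<Gamma> (coeff r i)) j = 0" for j
    proof -
      have other: "coeff (monom (t ^ k) (?N * k) * pcompose (\<Gamma> (coeff r k)) (monom ((- f3) ^ m) d)) (?N * i + d * j) = 0"
        if "k \<le> d - 1" "k \<noteq> i" for k
      proof -
        have "\<not> d dvd ?N * i + d * j - ?N * k" if "?N * k \<le> ?N * i + d * j"
        proof
          assume "d dvd ?N * i + d * j - ?N * k"
          then have "int d dvd int (?N * i + d * j - ?N * k)" by (simp only: int_dvd_int_iff)
          also have "int (?N * i + d * j - ?N * k) = int ?N * (int i - int k) + int d * int j"
            using that by (simp add: of_nat_diff algebra_simps)
          finally have "int d dvd int ?N * (int i - int k)" by (simp add: dvd_add_left_iff)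
          then have dv: "int d dvd int i - int k" using dvd_of_dvd_mult_coprime[OF coprime_abc_d] by blast
          have "\<bar>int i - int k\<bar> < int d" "int i - int k \<noteq> 0" using \<open>i \<le> d - 1\<close> \<open>k \<le> d - 1\<close> \<open>k \<noteq> i\<close> ge2 by linarith+
          with dv show False using dvd_imp_le_int[of "int i - int k" "int d"] by linarith
        qed
        then show ?thesis using ge2 by (auto simp: coeff_monom_mult intro!: coeff_pcompose_monom_eq_0)
      qed
      have "0 = (\<Sum>k\<le>d - 1. coeff (monom (t ^ k) (?N * k) * pcompose (\<Gamma> (coeff r k)) (monom ((- f3) ^ m) d)) (?N * i + d * j))"
        using arg_cong[OF sum0, of "\<lambda>p. coeff p (?N * i + d * j)"] by (simp add: coeff_sum)
      also have "\<dots> = coeff (monom (t ^ i) (?N * i) * pcompose (\<Gamma> (coeff r i)) (monom ((- f3) ^ m) d)) (?N * i + d * j)"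
        using that other by (subst sum.remove[of _ i]) (auto intro!: sum.neutral)
      also have "\<dots> = t ^ i * (coeff (\<Gamma> (coeff r i)) j * ((- f3) ^ m) ^ j)"
        using ge2 by (simp add: coeff_monom_mult coeff_pcompose_monom)
      finally show ?thesis using xyzt_nonzero(4) nonzero(2) by simp
    qed
    then have "\<Gamma> (coeff r i) = 0" by (simp add: poly_eq_iff)
    then show ?thesis using poly_Gamma_1[of "coeff r i"] by simp
  qed
  then have "r = 0" using deg_r by (metis leading_coeff_0_iff)
  then show ?thesis using u by (simp add: evT)
qed

lemma phi_eq_iff: "\<phi> u = \<phi> v \<longleftrightarrow> F dvd u - v"
proof
  assume "\<phi> u = \<phi> v"
  then show "F dvd u - v" using phi_eq_0_imp_dvd by (simp add: ring_map_diff[OF ring_map_phi])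
next
  assume "F dvd u - v"
  then have "\<phi> (u - v) = 0" by (auto simp: dvd_def phi_hom phi_F)
  then show "\<phi> u = \<phi> v" by (simp add: ring_map_diff[OF ring_map_phi])
qed

lemma range_phi: "range \<phi> = graded_span (range const3) gens"
proof
  have "\<phi> u \<in> graded_span (range const3) gens" for u
  proof (induction u rule: mpoly4_induct)
    case (1 k)
    show ?case unfolding phi_simps by (rule monom_hom_in_graded_span[OF monom_hom.const]) simp
  qed (auto simp: phi_simps phi_hom gens_def intro!: graded_span_add graded_span_mult monom_hom_in_graded_span[OF monom_hom.gen])
  then show "range \<phi> \<subseteq> graded_span (range const3) gens" by blast
  have add: "p + q \<in> range \<phi>" and mult: "p * q \<in> range \<phi>" if pq: "p \<in> range \<phi>" "q \<in> range \<phi>" for p q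
  proof -
    obtain u v where "p = \<phi> u" "q = \<phi> v" using pq by blast
    then have "p + q = \<phi> (u + v)" "p * q = \<phi> (u * v)" by (simp_all add: phi_hom)
    then show "p + q \<in> range \<phi>" "p * q \<in> range \<phi>" by blast+
  qed
  have zero: "0 \<in> range \<phi>" using rangeI[of \<phi> 0] by (simp add: phi_hom)
  have hom: "p \<in> range \<phi>" if "monom_hom (range const3) gens k p" for k p using that
  proof (induction rule: monom_hom.induct)
    case (const k)
    then obtain l where "k = const3 l" by blast
    then have "[:k:] = \<phi> (constC l)" by (simp add: phi_simps)
    then show ?case by blast
  next
    case (gen w u)
    then have "monom u w \<in> {\<phi> varX, \<phi> varY, \<phi> varZ, \<phi> varT}" unfolding gens_def phi_simps by auto
    then show ?case by auto
  qed (simp_all add: zero add mult)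
  have sum: "(\<Sum>i\<in>A. q i) \<in> range \<phi>" if "\<And>i. i \<in> A \<Longrightarrow> q i \<in> range \<phi>" for q and A :: "nat set"
    using that by (induction A rule: infinite_finite_induct) (simp_all add: zero add)
  show "graded_span (range const3) gens \<subseteq> range \<phi>"
  proof
    fix p assume "p \<in> graded_span (range const3) gens"
    then have "(\<Sum>i\<le>degree p. monom (coeff p i) i) \<in> range \<phi>"
      unfolding graded_span_def using hom by (intro sum) blast
    then show "p \<in> range \<phi>" by (simp add: poly_as_sum_of_monoms)
  qed
qed

text \<open>Each of \<open>c\<close> and \<open>d\<close> divides the weights of all generators but
  one, \<open>z\<close> and \<open>t\<close> respectively, and is prime to the weight of that one.
  So the homogeneous theorem kills \<open>\<Delta>\<close> on all generators, which a nonzero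
  \<open>D\<close> does not allow.\<close>

lemma lnd_on_range_zero:
  assumes D: "graded_lnd (range const3) gens D"
    and cop: "coprime (a * b * d) c" and ab: "a > 2 \<or> b > 2" and p: "p \<in> range \<phi>"
  shows "D p = 0"
proof (rule ccontr)
  assume nz: "D p \<noteq> 0"
  interpret D: graded_lnd "range const3" gens D by fact
  interpret H: homogeneous_lnd "monom_hom (range const3) gens" D.\<Delta> D.e by (rule D.homogeneous_lnd_top)
  have one: "1 \<in> range const3" using D.one .
  have c: "coprime (int (a * b * d)) (int c)" using cop by (simp only: coprime_int_iff)
  have g: "(b * c * d, x) \<in> gens" "(a * c * d, y) \<in> gens" "(a * b * d, z) \<in> gens" "(a * b * c, t) \<in> gens"
    by (auto simp: gens_def)
  note h = g[THEN monom_hom.gen, of "range const3"]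
  have others: "(w, u) = (a * b * c, t) \<or> d dvd w" "(w, u) = (a * b * d, z) \<or> c dvd w"
    if "(w, u) \<in> gens" for w u using that by (auto simp: gens_def)
  have t: "H.root_divides (monom t (a * b * c)) (int (a * b * c)) d"
    unfolding H.root_divides_def
    using h(4) xyzt_nonzero(4) ge2(4) coprime_abc_d
      monom_hom_root_dvd[OF one g(4) ge2(4) coprime_abc_d others(1)]
    by (metis monom_eq_0_iff)
  have z: "H.root_divides (monom z (a * b * d)) (int (a * b * d)) c"
    unfolding H.root_divides_def
    using h(3) xyzt_nonzero(3) ge2(3) c monom_hom_root_dvd[OF one g(3) ge2(3) c others(2)]
    by (metis monom_eq_0_iff)
  let ?x = "monom x (b * c * d)" and ?y = "monom y (a * c * d)"
    and ?z = "monom z (a * b * d)" and ?t = "monom t (a * b * c)"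
  have s: "?x ^ a + ?y ^ b = monom (x ^ a + y ^ b) (a * b * c * d)"
    by (simp add: monom_power add_monom[symmetric] ac_simps)
  have "?x ^ a + ?y ^ b + ?z ^ c + ?t ^ d = monom (x ^ a + y ^ b + z ^ c + t ^ d) (a * b * c * d)"
    by (simp add: monom_power add_monom[symmetric] ac_simps)
  then have rel: "?x ^ a + ?y ^ b + ?z ^ c + ?t ^ d = 0" by (simp add: relation)
  have zero: "D.\<Delta> ?x = 0" "D.\<Delta> ?y = 0" "D.\<Delta> ?z = 0" "D.\<Delta> ?t = 0"
    using H.brieskorn_homogeneous_derivation_zero[OF t z _ _ _ _ _ _ h(1,2) _ _ _ _ _ ge2(1,2) ab rel]
      xyzt_nonzero s by (simp_all add: ac_simps)
  obtain w u where "(w, u) \<in> gens" "D.\<Delta> (monom u w) \<noteq> 0"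
    using D.\<Delta>_nonzero p nz range_phi by blast
  with zero show False by (auto simp: gens_def)
qed

end

section \<open>Transfer to the quotient ring\<close>

lemma polyring4_simps [simp]:
  "carrier polyring4 = UNIV" "u \<otimes>\<^bsub>polyring4\<^esub> v = u * v" "u \<oplus>\<^bsub>polyring4\<^esub> v = u + v"
  "\<one>\<^bsub>polyring4\<^esub> = 1" "\<zero>\<^bsub>polyring4\<^esub> = 0"
  by (simp_all add: polyring4_def)

lemma cring_polyring4: "cring polyring4"
proof (rule cringI)
  show "abelian_group polyring4"
  proof (rule abelian_groupI)
    fix u assume "u \<in> carrier polyring4"
    show "\<exists>v\<in>carrier polyring4. v \<oplus>\<^bsub>polyring4\<^esub> u = \<zero>\<^bsub>polyring4\<^esub>"
      by (rule bexI[of _ "- u"]) simp_all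
  qed (simp_all add: ac_simps)
  show "comm_monoid polyring4" by (rule comm_monoidI) (simp_all add: ac_simps)
qed (simp add: algebra_simps)

lemma hyper_ideal_eq: "hyper_ideal a b c d = {u. varX ^ a + varY ^ b + varZ ^ c + varT ^ d dvd u}"
proof -
  interpret cring polyring4 by (rule cring_polyring4)
  have "hyper_ideal a b c d = PIdl\<^bsub>polyring4\<^esub> (varX ^ a + varY ^ b + varZ ^ c + varT ^ d)"
    unfolding hyper_ideal_def by (simp add: cgenideal_eq_genideal)
  then show ?thesis by (auto simp: cgenideal_def dvd_def mult.commute)
qed

lemma ideal_hyper_ideal: "ideal (hyper_ideal a b c d) polyring4"
  unfolding hyper_ideal_def using cring_polyring4 by (intro ring.genideal_ideal) (auto simp: cring_def)

context
  fixes a b c d :: nat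
begin

definition hyper_class :: "mpoly4 \<Rightarrow> mpoly4 set" where
  "hyper_class u = a_r_coset polyring4 (hyper_ideal a b c d) u"

lemma hyper_class_eq_iff:
  "hyper_class u = hyper_class v \<longleftrightarrow> varX ^ a + varY ^ b + varZ ^ c + varT ^ d dvd u - v"
proof -
  let ?F = "varX ^ a + varY ^ b + varZ ^ c + varT ^ d"
  have cls: "w \<in> hyper_class u \<longleftrightarrow> ?F dvd w - u" for u w
  proof -
    have "w \<in> hyper_class u \<longleftrightarrow> (\<exists>h. ?F dvd h \<and> w = h + u)"
      by (auto simp: hyper_class_def a_r_coset_def' hyper_ideal_eq)
    also have "\<dots> \<longleftrightarrow> ?F dvd w - u" by (metis add_diff_cancel diff_add_cancel)
    finally show ?thesis .
  qed
  show ?thesis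
  proof
    assume "hyper_class u = hyper_class v"
    moreover have "u \<in> hyper_class u" by (simp add: cls)
    ultimately show "?F dvd u - v" using cls by blast
  next
    assume "?F dvd u - v"
    then have "?F dvd w - u \<longleftrightarrow> ?F dvd w - v" for w
      using dvd_add_left_iff[of ?F "u - v" "w - u"] by simp
    then show "hyper_class u = hyper_class v" using cls by blast
  qed
qed

lemma hyper_class_hom:
  "hyper_class (u + v) = hyper_class u \<oplus>\<^bsub>hyper_ring a b c d\<^esub> hyper_class v"
  "hyper_class (u * v) = hyper_class u \<otimes>\<^bsub>hyper_ring a b c d\<^esub> hyper_class v"
  "hyper_class 1 = \<one>\<^bsub>hyper_ring a b c d\<^esub>"
  "hyper_class 0 = \<zero>\<^bsub>hyper_ring a b c d\<^esub>"
proof -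
  have h: "hyper_class \<in> ring_hom polyring4 (hyper_ring a b c d)"
    using ideal.rcos_ring_hom[OF ideal_hyper_ideal] unfolding hyper_ring_def hyper_class_def .
  show "hyper_class (u + v) = hyper_class u \<oplus>\<^bsub>hyper_ring a b c d\<^esub> hyper_class v"
    "hyper_class (u * v) = hyper_class u \<otimes>\<^bsub>hyper_ring a b c d\<^esub> hyper_class v"
    "hyper_class 1 = \<one>\<^bsub>hyper_ring a b c d\<^esub>"
    using ring_hom_add[OF h] ring_hom_mult[OF h] ring_hom_one[OF h] by simp_all
  show "hyper_class 0 = \<zero>\<^bsub>hyper_ring a b c d\<^esub>"
    by (auto simp: hyper_class_def a_r_coset_def' hyper_ring_def FactRing_def)
qed

lemma carrier_hyper_ring: "carrier (hyper_ring a b c d) = range hyper_class"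
  by (auto simp: hyper_ring_def FactRing_def A_RCOSETS_def' hyper_class_def)

lemma hyper_emb_eq: "hyper_emb a b c d k = hyper_class (constC k)"
  by (simp add: hyper_emb_def hyper_class_def)

end

section \<open>Transport of derivations to the image of the embedding\<close>

context brieskorn_embedding
begin

abbreviation "cls \<equiv> hyper_class a b c d"

text \<open>With \<open>of_class\<close>, mutually inverse identifications of the quotient ring and
  the image of \<open>\<phi>\<close>; any representative may be chosen because \<open>\<phi>\<close>
  and \<open>cls\<close> have the same fibres.\<close>

definition to_class :: "mpoly3 poly \<Rightarrow> mpoly4 set" where "to_class p = cls (SOME u. \<phi> u = p)"
definition of_class :: "mpoly4 set \<Rightarrow> mpoly3 poly" where "of_class C = \<phi> (SOME u. cls u = C)"

lemma cls_eq_iff: "cls u = cls v \<longleftrightarrow> \<phi> u = \<phi> v"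
  by (simp add: hyper_class_eq_iff phi_eq_iff F_def)

lemma to_class_phi: "to_class (\<phi> u) = cls u"
  unfolding to_class_def cls_eq_iff by (rule someI[of "\<lambda>v. \<phi> v = \<phi> u"]) simp

lemma of_class_cls: "of_class (cls u) = \<phi> u"
  unfolding of_class_def cls_eq_iff[symmetric] by (rule someI[of "\<lambda>v. cls v = cls u"]) simp

lemma lnd_transport:
  assumes "is_LND (hyper_ring a b c d) (hyper_emb a b c d) D"
  shows "graded_lnd (range const3) gens (\<lambda>p. of_class (D (to_class p)))"
proof -
  let ?B = "hyper_ring a b c d"
  note hom = hyper_class_hom[of a b c d]
  define D' where "D' = (\<lambda>p. of_class (D (to_class p)))"
  have closed: "\<exists>v. D (cls u) = cls v" for u
    using assms unfolding is_LND_def carrier_hyper_ring by blast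
  have D': "D' (\<phi> u) = \<phi> v" if "D (cls u) = cls v" for u v
    by (simp add: D'_def to_class_phi that of_class_cls)
  have add: "D' (\<phi> u + \<phi> v) = D' (\<phi> u) + D' (\<phi> v)" for u v
  proof -
    obtain u' v' where uv: "D (cls u) = cls u'" "D (cls v) = cls v'" using closed by blast
    have "D (cls (u + v)) = cls (u' + v')"
      using assms uv unfolding is_LND_def carrier_hyper_ring hom by (metis rangeI)
    from D'[OF this] D'[OF uv(1)] D'[OF uv(2)] show ?thesis by (simp add: phi_hom)
  qed
  have mult: "D' (\<phi> u * \<phi> v) = \<phi> u * D' (\<phi> v) + D' (\<phi> u) * \<phi> v" for u v
  proof -
    obtain u' v' where uv: "D (cls u) = cls u'" "D (cls v) = cls v'" using closed by blast
    have "D (cls (u * v)) = cls (u * v' + u' * v)"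
      using assms uv unfolding is_LND_def carrier_hyper_ring hom by (metis rangeI)
    from D'[OF this] D'[OF uv(1)] D'[OF uv(2)] show ?thesis by (simp add: phi_hom)
  qed
  have one: "D' 1 = 0" using mult[of 1 1] by (simp add: phi_hom)
  \<comment> \<open>Linearity gives D(k 1) = k D(1), and D(1) = 0 by the Leibniz rule, so constants
    are killed.\<close>
  have const: "D' [:const3 k:] = 0" for k
  proof -
    obtain v where v: "D (cls 1) = cls v" using closed by blast
    have "D (hyper_emb a b c d k \<otimes>\<^bsub>?B\<^esub> cls 1) = hyper_emb a b c d k \<otimes>\<^bsub>?B\<^esub> D (cls 1)"
      using assms unfolding is_LND_def carrier_hyper_ring by blast
    then have "D (cls (constC k * 1)) = cls (constC k * v)"
      unfolding hyper_emb_eq v hom(2)[symmetric] .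
    from D'[OF this] D'[OF v] one show ?thesis by (simp add: phi_hom phi_simps)
  qed
  have iter: "\<exists>v. (D ^^ k) (cls u) = cls v \<and> (D' ^^ k) (\<phi> u) = \<phi> v" for k u
  proof (induction k)
    case (Suc k)
    then obtain v w where "(D ^^ k) (cls u) = cls v" "(D' ^^ k) (\<phi> u) = \<phi> v" "D (cls v) = cls w"
      using closed by blast
    then show ?case using D' by auto
  qed auto
  have nil: "\<exists>k. (D' ^^ k) (\<phi> u) = 0" for u
  proof -
    obtain k where "(D ^^ k) (cls u) = cls 0"
      using assms unfolding is_LND_def carrier_hyper_ring hom by blast
    then show ?thesis using iter[of k u] cls_eq_iff phi_hom(4) by metis
  qed
  have "graded_lnd (range const3) gens D'"
  proof
    show "1 \<in> range const3" "-1 \<in> range const3"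
      by (rule range_eqI[of _ _ 1], simp add: const3_def one_pCons,
          rule range_eqI[of _ _ "-1"], simp add: const3_def one_pCons)
    show "finite gens" by (simp add: gens_def)
    show "D' [:k:] = 0" if "k \<in> range const3" for k using that const by blast
  next
    fix p assume "p \<in> graded_span (range const3) gens"
    then obtain u where u: "p = \<phi> u" unfolding range_phi[symmetric] by blast
    show "D' p \<in> graded_span (range const3) gens"
      unfolding range_phi[symmetric] u D'_def to_class_phi using closed[of u] by (auto simp: of_class_cls)
    show "\<exists>k. (D' ^^ k) p = 0" using nil u by blast
    fix q assume "q \<in> graded_span (range const3) gens"
    then obtain v where v: "q = \<phi> v" unfolding range_phi[symmetric] by blast
    show "D' (p + q) = D' p + D' q" "D' (p * q) = p * D' q + D' p * q" using add mult u v by auto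
  qed
  then show ?thesis unfolding D'_def .
qed

lemma rigid_hyper_ring:
  assumes "coprime (a * b * d) c" and "a > 2 \<or> b > 2"
  shows "rigid (hyper_ring a b c d) (hyper_emb a b c d)"
  unfolding rigid_def
proof (intro allI impI ballI)
  fix D C assume D: "is_LND (hyper_ring a b c d) (hyper_emb a b c d) D" and C: "C \<in> carrier (hyper_ring a b c d)"
  obtain u v where u: "C = cls u" and v: "D C = cls v"
    using D C unfolding is_LND_def carrier_hyper_ring by blast
  have "of_class (D (to_class (\<phi> u))) = 0"
    using lnd_on_range_zero[OF lnd_transport[OF D] assms] by blast
  then have "\<phi> v = \<phi> 0" using u v by (simp add: to_class_phi of_class_cls phi_hom)
  then show "D C = \<zero>\<^bsub>hyper_ring a b c d\<^esub>" using v cls_eq_iff hyper_class_hom(4) by metis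
qed

end

theorem theorem7p14:
  fixes a b c d :: nat
  assumes "a \<ge> 2" and "b \<ge> 2" and "c \<ge> 2" and "d \<ge> 2"
    and "length (filter (\<lambda>k. k = 2) [a, b, c, d]) \<le> 1"
    and "gcd (a * b) c = 1" and "gcd (a * b * c) d = 1"
    and "gcd a b \<notin> {a, b}"
  shows "rigid (hyper_ring a b c d) (hyper_emb a b c d)"
proof -
  have abc: "coprime (a * b * c) d" and ab: "coprime (a * b) c"
    using assms(6,7) by (simp_all only: coprime_iff_gcd_eq_1)
  then have "coprime d c" by (simp add: coprime_commute)
  with ab have c: "coprime (a * b * d) c" by simp
  have ab2: "a > 2 \<or> b > 2" using assms(1,2,5) by (auto split: if_splits)
  have "coprime (int (a * b * c)) (int d)" "d > 0" using abc assms(4) by (simp_all only: coprime_int_iff)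
  \<comment> \<open>\<open>m\<close> is minus the inverse of \<open>a * b * c\<close> modulo
    \<open>d\<close>, which makes \<open>a * b * c * m + 1\<close> a multiple of \<open>d\<close>,
    as the embedding needs.\<close>
  then obtain m where "int d dvd - 1 - int (a * b * c) * int m" using coprime_residue by blast
  then have "int d dvd int (a * b * c * m + 1)"
    by (metis (no_types, lifting) dvd_minus_iff minus_diff_eq diff_minus_eq_add of_nat_add of_nat_mult of_nat_1 add.commute)
  then obtain n where "a * b * c * m + 1 = d * n" by (metis dvdE int_dvd_int_iff)
  then interpret brieskorn_embedding a b c d m n using assms by unfold_locales auto
  show ?thesis using rigid_hyper_ring[OF c ab2] .
qed

end
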